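(* Let $\alpha\in(0,1]$, let $\mu_\alpha$ be the probability measure given by normalizing $\mu$ on $\Omega_\alpha$, let $\nu_\alpha$ be the marginal measure on $\mathbb{I}_\alpha$ obtained by integrating $\mu_\alpha$ over the fibers $\{x\}\times\{y\mid (x,y)\in\Omega_\alpha\}$, let $\mathscr{B}_\alpha$ be the Borel $\sigma$-algebra of $\mathbb{I}_\alpha$, and let $\mathscr{B}'_\alpha$ be the Borel $\sigma$-algebra of $\Omega_\alpha$. Then $(\Omega_\alpha,\mathcal{T}_\alpha,\mathscr{B}'_\alpha,\mu_\alpha)$ is a natural extension of $(\mathbb{I}_\alpha,T_\alpha,\mathscr{B}_\alpha,\nu_\alpha)$.
   Context: For $\alpha\in[0,1]$ let $\mathbb{I}_\alpha=[\alpha-1,\alpha]$ and define $T_\alpha:\mathbb{I}_\alpha\to[\alpha-1,\alpha)$ by $T_\alpha(x)=|1/x|-\lfloor |1/x|+1-\alpha\rfloor$ for $x\neq0$ and $T_\alpha(0)=0$. Put $\varepsilon(x)=+1$ if $x\ge0$, $\varepsilon(x)=-1$ if $x<0$, and $d_\alpha(x)=\lfloor|1/x|+1-\alpha\rfloor$ for $x\ne0$, $d_\alpha(0)=\infty$. The planar map is $\mathcal{T}_\alpha(x,y)=\big(T_\alpha(x),\frac{1}{d_\alpha(x)+\varepsilon(x)y}\big)$ for $x\in\mathbb{I}_\alpha$, $y\in[0,1]$ (with second coordinate $0$ when $x=0$). For $\alpha\in(0,1]$, $\Omega_\alpha=\overline{\{\mathcal{T}_\alpha^n(x,0)\mid x\in[\alpha-1,\alpha),\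 n\ge0\}}$. The measure $\mu$ on $\mathbb{I}_\alpha\times[0,1]$ is given by $d\mu=\frac{dx\,dy}{(1+xy)^2}$; one has $0<\mu(\Omega_\alpha)<\infty$. A natural extension of a measure-preserving system is an invertible measure-preserving system (invertibility being understood up to sets of measure zero) which has the original system as a factor and is minimal with this property: (1) there is a surjective measurable factor map $\pi$ (here the projection to the first coordinate) carrying the invariant measure of the extension to that of the original system; (2) $\pi\circ\mathcal{T}_\alpha=T_\alpha\circ\pi$; (3) $\mathcal{T}_\alpha$ is invertible; (4) any invertible system that admits $(\mathbb{I}_\alpha,T_\alpha,\mathscr{B}_\alpha,\nu_\alpha)$ as a factor itself has $(\Omega_\alpha,\mathcal{T}_\alpha,\mathscr{B}'_\alpha,\mu_\alpha)$ as a factor. (Criterion (4) is verified in the standard way by $\mathscr{B}'_\alpha=\bigvee_{n\ge0}\mathcal{T}_\alpha^n\pi^{-1}\mathscr{B}_\alpha$, up to null sets.) *)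

theory Defs
  imports "HOL-Probability.Probability"
begin

definition Ival :: "real \<Rightarrow> real set" where
  "Ival \<alpha> = {\<alpha> - 1..\<alpha>}"

definition eps :: "real \<Rightarrow> real" where
  "eps x = (if x \<ge> 0 then 1 else -1)"

text \<open>Only used for nonzero \<open>x\<close>: the convention that the digit of \<open>0\<close> is infinite is
  built into \<open>planar_map\<close>, whose second coordinate is \<open>0\<close> at \<open>x = 0\<close>.\<close>

definition digit :: "real \<Rightarrow> real \<Rightarrow> int" where
  "digit \<alpha> x = \<lfloor>\<bar>1 / x\<bar> + 1 - \<alpha>\<rfloor>"

definition cf_map :: "real \<Rightarrow> real \<Rightarrow> real" where
  "cf_map \<alpha> x = (if x = 0 then 0 else \<bar>1 / x\<bar> - of_int (digit \<alpha> x))"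

definition planar_map :: "real \<Rightarrow> real \<times> real \<Rightarrow> real \<times> real" where
  "planar_map \<alpha> = (\<lambda>(x, y).
     (cf_map \<alpha> x, if x = 0 then 0 else 1 / (of_int (digit \<alpha> x) + eps x * y)))"

definition Omega :: "real \<Rightarrow> (real \<times> real) set" where
  "Omega \<alpha> = closure {(planar_map \<alpha> ^^ n) (x, 0) | x n. x \<in> {\<alpha> - 1..<\<alpha>}}"

definition mu :: "real \<Rightarrow> (real \<times> real) measure" where
  "mu \<alpha> = density (restrict_space lborel (Ival \<alpha> \<times> {0..1}))
             (\<lambda>(x, y). ennreal (1 / (1 + x * y)\<^sup>2))"

definition mu_alpha :: "real \<Rightarrow> (real \<times> real) measure" where
  "mu_alpha \<alpha> =
     scale_measure (1 / emeasure (mu \<alpha>) (Omega \<alpha>)) (restrict_space (mu \<alpha>) (Omega \<alpha>))"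

definition nu_alpha :: "real \<Rightarrow> real measure" where
  "nu_alpha \<alpha> = density (restrict_space lborel (Ival \<alpha>))
     (\<lambda>x. (\<integral>\<^sup>+ y \<in> {y. (x, y) \<in> Omega \<alpha>}. ennreal (1 / (1 + x * y)\<^sup>2) \<partial>lborel)
            / emeasure (mu \<alpha>) (Omega \<alpha>))"

text \<open>The carrier of \<open>mu_alpha \<alpha>\<close> is \<open>Omega \<alpha>\<close> with its Borel sets, and that of
  \<open>nu_alpha \<alpha>\<close> is the interval with its Borel sets.\<close>

lemma planar_map_in:
  assumes "0 < \<alpha>" "\<alpha> \<le> 1" "p \<in> Ival \<alpha> \<times> {0..1}"
  shows "planar_map \<alpha> p \<in> Ival \<alpha> \<times> {0..1}"
proof -
  obtain x y where p: "p = (x, y)" by (cases p)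
  have x: "\<alpha> - 1 \<le> x" "x \<le> \<alpha>" and y: "0 \<le> y" "y \<le> 1"
    using assms(3) by (auto simp: p Ival_def)
  show ?thesis
  proof (cases "x = 0")
    case True
    then show ?thesis using assms by (simp add: p planar_map_def cf_map_def Ival_def)
  next
    case False
    define d where "d = digit \<alpha> x"
    have d: "of_int d \<le> \<bar>1 / x\<bar> + 1 - \<alpha>" "\<bar>1 / x\<bar> + 1 - \<alpha> < of_int d + 1"
      unfolding d_def digit_def by linarith+
    have le: "1 \<le> of_int d + eps x * y"
    proof (cases "x > 0")
      case True
      have "1 / \<alpha> \<le> 1 / x" using True x assms by (intro divide_left_mono) auto
      moreover have "1 \<le> 1 / \<alpha>" using assms by simp
      moreover have "\<bar>1 / x\<bar> = 1 / x" using True by simp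
      ultimately have "0 < (of_int d :: real)" using d(2) assms(2) by linarith
      then have "1 \<le> d" by simp
      then have "(1::real) \<le> of_int d" by linarith
      then show ?thesis using True y by (simp add: eps_def)
    next
      case neg: False
      define s where "s = 1 - \<alpha>"
      have s: "0 < s" "- x \<le> s" "0 < - x" using neg False x by (auto simp: s_def)
      have "1 / s \<le> 1 / (- x)" using s by (intro frac_le) auto
      moreover have "2 \<le> 1 / s + s"
        using s(1) by (simp add: field_simps) (metis sum_squares_bound mult_2 mult.commute
            mult_1 one_power2 power2_eq_square)
      moreover have "\<bar>1 / x\<bar> = 1 / (- x)" using s by (simp add: abs_if)
      ultimately have "2 \<le> d"
        unfolding d_def digit_def s_def by (simp add: le_floor_iff)
      then have "(2::real) \<le> of_int d" by linarith
      then show ?thesis using neg False y by (simp add: eps_def)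
    qed
    have "\<bar>1 / x\<bar> - of_int d \<in> Ival \<alpha>" using d by (simp add: Ival_def)
    moreover have "1 / (of_int d + eps x * y) \<in> {0..1}" using le by simp
    ultimately show ?thesis
      using False by (simp add: p planar_map_def cf_map_def d_def)
  qed
qed

lemma Omega_subset:
  assumes "0 < \<alpha>" "\<alpha> \<le> 1"
  shows "Omega \<alpha> \<subseteq> Ival \<alpha> \<times> {0..1}"
proof -
  have *: "(planar_map \<alpha> ^^ n) (x, 0) \<in> Ival \<alpha> \<times> {0..1}" if "x \<in> {\<alpha> - 1..<\<alpha>}" for x n
    using that
  proof (induction n)
    case 0
    then show ?case by (auto simp: Ival_def)
  next
    case (Suc n)
    then show ?case using planar_map_in[OF assms] by simp
  qed
  have "closed (Ival \<alpha> \<times> {0..1::real})"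
    unfolding Ival_def by (intro closed_Times) auto
  then show ?thesis
    unfolding Omega_def using * by (intro closure_minimal) blast+
qed

lemma
  assumes "0 < \<alpha>" "\<alpha> \<le> 1"
  shows space_mu_alpha: "space (mu_alpha \<alpha>) = Omega \<alpha>"
    and sets_mu_alpha: "sets (mu_alpha \<alpha>) = sets (restrict_space borel (Omega \<alpha>))"
proof -
  note sub = Omega_subset[OF assms]
  show "space (mu_alpha \<alpha>) = Omega \<alpha>"
    using sub by (auto simp: mu_alpha_def mu_def space_scale_measure space_restrict_space)
  have "sets (mu_alpha \<alpha>)
      = sets (restrict_space (restrict_space lborel (Ival \<alpha> \<times> {0..1})) (Omega \<alpha>))"
    unfolding mu_alpha_def mu_def sets_scale_measure by (intro sets_restrict_space_cong) simp
  also have "\<dots> = sets (restrict_space lborel (Omega \<alpha>))"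
    using sub unfolding sets_restrict_space image_image
    by (intro image_cong) auto
  also have "\<dots> = sets (restrict_space borel (Omega \<alpha>))"
    by (intro sets_restrict_space_cong) simp
  finally show "sets (mu_alpha \<alpha>) = sets (restrict_space borel (Omega \<alpha>))" .
qed

lemma
  shows space_nu_alpha: "space (nu_alpha \<alpha>) = Ival \<alpha>"
    and sets_nu_alpha: "sets (nu_alpha \<alpha>) = sets (restrict_space borel (Ival \<alpha>))"
  unfolding nu_alpha_def by (auto simp: space_restrict_space cong: sets_restrict_space_cong)

text \<open>A probability space with a measure-preserving self-map. If \<open>T\<close> maps \<open>space M\<close> into
  itself, the second conjunct says that \<open>T\<close> is measurable and \<open>distr M M T = M\<close>. In general
  (take \<open>A = space M\<close>) it says that the set of points that \<open>T\<close> maps out of \<open>space M\<close> is a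
  measurable null set, so \<open>T\<close> is a self-map up to null sets. This generality is needed:
  \<open>Omega \<alpha>\<close> is a closure and \<open>planar_map \<alpha>\<close> is discontinuous, so points of \<open>Omega \<alpha>\<close> over
  a discontinuity need not be mapped into \<open>Omega \<alpha>\<close>.\<close>

definition measure_preserving_system :: "'a measure \<Rightarrow> ('a \<Rightarrow> 'a) \<Rightarrow> bool" where
  "measure_preserving_system M T \<longleftrightarrow>
     prob_space M \<and>
     (\<forall>A\<in>sets M. T -` A \<inter> space M \<in> sets M \<and>
                  emeasure M (T -` A \<inter> space M) = emeasure M A)"

lemma measure_preserving_system_iff_distr:
  assumes "T \<in> space M \<rightarrow> space M"
  shows "measure_preserving_system M T \<longleftrightarrow>
           prob_space M \<and> T \<in> measurable M M \<and> distr M M T = M"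
proof
  assume L: "measure_preserving_system M T"
  then have T: "T \<in> measurable M M"
    using assms by (auto simp: measure_preserving_system_def measurable_def)
  have "distr M M T = M"
    by (rule measure_eqI) (use L T in \<open>auto simp: measure_preserving_system_def emeasure_distr\<close>)
  then show "prob_space M \<and> T \<in> measurable M M \<and> distr M M T = M"
    using L T by (simp add: measure_preserving_system_def)
next
  assume R: "prob_space M \<and> T \<in> measurable M M \<and> distr M M T = M"
  then show "measure_preserving_system M T"
    unfolding measure_preserving_system_def
    by (metis emeasure_distr measurable_sets)
qed

definition invertible_system :: "'a measure \<Rightarrow> ('a \<Rightarrow> 'a) \<Rightarrow> bool" where
  "invertible_system M T \<longleftrightarrow>
     measure_preserving_system M T \<and>
     (\<exists>S. measure_preserving_system M S \<and>
          (AE x in M. S (T x) = x) \<and> (AE x in M. T (S x) = x))"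

text \<open>\<open>p\<close> exhibits \<open>(N, T)\<close> as a factor of \<open>(M, S)\<close>, up to null sets. Surjectivity up to
  null sets is a consequence of the invariance of the measures, see the lemma below.\<close>

definition factor_map ::
    "'a measure \<Rightarrow> ('a \<Rightarrow> 'a) \<Rightarrow> 'b measure \<Rightarrow> ('b \<Rightarrow> 'b) \<Rightarrow> ('a \<Rightarrow> 'b) \<Rightarrow> bool" where
  "factor_map M S N T p \<longleftrightarrow>
     p \<in> measurable M N \<and> distr M N p = N \<and> (AE x in M. p (S x) = T (p x))"

lemma factor_map_surj_mod_null:
  assumes "factor_map M S N T p" "A \<in> sets N" "A \<inter> p ` space M = {}"
  shows "A \<in> null_sets N"
proof -
  have p: "p \<in> measurable M N" "distr M N p = N"
    using assms(1) by (simp_all add: factor_map_def)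
  have "p -` A \<inter> space M = {}" using assms(3) by auto
  then have "emeasure (distr M N p) A = 0"
    using emeasure_distr[OF p(1) assms(2)] by simp
  then show ?thesis using assms(2) p(2) by (simp add: null_sets_def)
qed

definition has_factor ::
    "'a measure \<Rightarrow> ('a \<Rightarrow> 'a) \<Rightarrow> 'b measure \<Rightarrow> ('b \<Rightarrow> 'b) \<Rightarrow> bool" where
  "has_factor M S N T \<longleftrightarrow> (\<exists>p. factor_map M S N T p)"

text \<open>\<open>(M, S)\<close> is a natural extension of \<open>(N, T)\<close> with factor map \<open>p\<close>. For \<open>p\<close> itself,
  surjectivity and equivariance are required at every point. HOL cannot quantify over types
  inside a formula, so the carrier type \<open>'c\<close> of the competing invertible systems is a
  parameter; a theorem with \<open>'c\<close> free covers all of them.\<close>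

definition natural_extension ::
    "'c itself \<Rightarrow> 'a measure \<Rightarrow> ('a \<Rightarrow> 'a) \<Rightarrow> 'b measure \<Rightarrow> ('b \<Rightarrow> 'b) \<Rightarrow> ('a \<Rightarrow> 'b) \<Rightarrow> bool" where
  "natural_extension (_ :: 'c itself) M S N T p \<longleftrightarrow>
     measure_preserving_system M S \<and>
     measure_preserving_system N T \<and>
     p \<in> measurable M N \<and> p ` space M = space N \<and> distr M N p = N \<and>
     (\<forall>x\<in>space M. p (S x) = T (p x)) \<and>
     invertible_system M S \<and>
     (\<forall>(K :: 'c measure) R.
        invertible_system K R \<and> has_factor K R N T \<longrightarrow> has_factor K R M S)"

end

theory Submission
  imports Defs
begin

text \<open>
  Each branch of \<open>planar_map \<alpha>\<close> acts on \<open>x\<close> and on \<open>t = - 1 / y\<close> by the same Moebius transformation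
  \<open>s \<mapsto> e / s - d\<close>, where \<open>d\<close> is the digit and \<open>e\<close> the sign of \<open>x\<close>. The measure with density
  \<open>1 / (1 + x y)\<^sup>2\<close> is the form of the Moebius invariant measure \<open>dx dt / (x - t)\<^sup>2\<close> in these
  coordinates, so every branch preserves it. Three facts about \<open>Omega \<alpha>\<close> turn this local statement
  into the theorem.

  Tiling. Up to null sets, \<open>planar_map \<alpha>\<close> maps \<open>Omega \<alpha>\<close> into itself, since it is continuous off
  countably many vertical lines and \<open>Omega \<alpha>\<close> is the closure of a forward invariant set
  (\<open>planar_map_Omega\<close>). Up to null sets it also maps \<open>Omega \<alpha>\<close> onto itself: at height \<open>y > 0\<close> only
  finitely many digits occur, and compactness carries preimages to the limit (\<open>Omega_covered\<close>). The
  images of the countably many pieces on which the map is a single branch therefore cover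
  \<open>Omega \<alpha>\<close>, while their measures add up to that of \<open>Omega \<alpha>\<close>, which is finite. Hence the
  images overlap in null sets only (\<open>AE_piece_images_tile_Omega\<close>), and \<open>planar_map \<alpha>\<close> is almost
  everywhere bijective on \<open>Omega \<alpha>\<close> and preserves its measure.

  Positive measure. \<open>Omega \<alpha>\<close> contains a rectangle \<open>(\<alpha> - 1, \<alpha>) \<times> (0, \<alpha>\<^sup>3 / 32)\<close>
  (\<open>Omega_contains_rectangle\<close>). A point \<open>(x, y)\<close> of the rectangle with \<open>x\<close> irrational and \<open>y\<close> rational is
  actually hit by an orbit. Take a matrix in \<open>GL(2, \<int>)\<close> that sends \<open>- 1 / y\<close> to \<open>\<infinity>\<close>, and start at the
  image \<open>z\<close> of \<open>x\<close>, at height \<open>0\<close>. The image of \<open>\<infinity>\<close> is a rational number very close to \<open>z\<close> relative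
  to its denominator. This stays true along the orbit of \<open>z\<close>, so each step simplifies that rational
  number, until it becomes \<open>0\<close> (\<open>cusp_step\<close>). The next step sends it to \<open>\<infinity>\<close>,
  and then the orbit is at \<open>(x, y)\<close> (\<open>orbit_hits_target\<close>). This is a Legendre type theorem: a
  sufficiently good rational approximation is a convergent of the expansion.

  Contraction. Two points on the same vertical fibre are at distance at most \<open>1 / (n + 1)\<close> after \<open>n\<close>
  steps (\<open>fibre_contraction\<close>). So the height of a point of \<open>Omega \<alpha>\<close> is determined by the first
  coordinates of its past. Given an invertible system \<open>K\<close> over \<open>nu_alpha \<alpha>\<close>, the past of a point of
  \<open>K\<close> gives a sequence \<open>x 0, x 1, \<dots>\<close> in the interval with \<open>x n = cf_map \<alpha> (x (n + 1))\<close>. The points reached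
  after \<open>n\<close> steps from \<open>(x n, 0)\<close> converge, and their limit defines the factor map from \<open>K\<close> to \<open>Omega \<alpha>\<close>.
  Its law is the limit of the laws of these approximations, which depend on \<open>nu_alpha \<alpha>\<close> only. They are
  the same when \<open>K\<close> is \<open>mu_alpha \<alpha>\<close> itself, where the limit is the identity; so the law is
  \<open>mu_alpha \<alpha>\<close> (\<open>mu_alpha_minimal\<close>).
\<close>

section \<open>Moebius invariance of the planar density\<close>

lemma nn_integral_uminus_real:
  fixes f :: "real \<Rightarrow> ennreal"
  assumes [measurable]: "f \<in> borel_measurable borel"
  shows "(\<integral>\<^sup>+x. f x \<partial>lborel) = (\<integral>\<^sup>+x. f (- x) \<partial>lborel)"
  using nn_integral_real_affine[of f "-1" 0] by simp

lemma nn_integral_shift_real: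
  fixes f :: "real \<Rightarrow> ennreal"
  assumes [measurable]: "f \<in> borel_measurable borel"
  shows "(\<integral>\<^sup>+x. f x \<partial>lborel) = (\<integral>\<^sup>+x. f (d + x) \<partial>lborel)"
  using nn_integral_real_affine[of f "1" d] by simp

text \<open>On the negative half-line the inversion is written as \<open>t \<mapsto> - 1 / t\<close> with \<open>t > 0\<close>, which is
  increasing, as the substitution rule on compact intervals requires. The half-line is exhausted by the intervals
  \<open>K n\<close>.\<close>

lemma emeasure_negative_inversion:
  fixes A :: "real set"
  assumes [measurable]: "A \<in> sets borel"
  shows "emeasure lborel (A \<inter> {..<0})
    = (\<integral>\<^sup>+t. ennreal (1 / t\<^sup>2) * indicator {0<..} t * indicator A (- 1 / t) \<partial>lborel)"
proof -
  define N where "N = distr (density lborel (\<lambda>t::real. ennreal (1 / t\<^sup>2) * indicator {0<..} t)) borel (\<lambda>t. - 1 / t)"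
  define K where "K n = {- real (Suc n)..- 1 / real (Suc n)}" for n
  have emN: "emeasure N E = (\<integral>\<^sup>+t. ennreal (1 / t\<^sup>2) * indicator {0<..} t * indicator E (- 1 / t) \<partial>lborel)"
    if [measurable]: "E \<in> sets borel" for E
  proof -
    have "emeasure N E = (\<integral>\<^sup>+t. indicator E t \<partial>N)" by (simp add: N_def)
    also have "\<dots> = (\<integral>\<^sup>+t. ennreal (1 / t\<^sup>2) * indicator {0<..} t * indicator E (- 1 / t) \<partial>lborel)"
      unfolding N_def by (subst nn_integral_distr) (simp_all add: nn_integral_density)
    finally show ?thesis .
  qed
  have step: "emeasure lborel (A \<inter> K n) = emeasure N (A \<inter> K n)" for n
  proof -
    define a where "a = 1 / real (Suc n)"
    define b where "b = real (Suc n)"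
    have ab: "0 < a" "a \<le> b" by (auto simp: a_def b_def field_simps)
    have K: "K n = {- 1 / a..- 1 / b}" by (simp add: K_def a_def b_def)
    have "emeasure lborel (A \<inter> K n) = (\<integral>\<^sup>+x. ennreal (indicator A x * indicator {- 1 / a..- 1 / b} x) \<partial>lborel)"
    proof -
      have "emeasure lborel (A \<inter> K n) = (\<integral>\<^sup>+x. indicator (A \<inter> K n) x \<partial>lborel)"
        by (rule nn_integral_indicator[symmetric]) (simp add: K)
      also have "\<dots> = (\<integral>\<^sup>+x. ennreal (indicator A x * indicator {- 1 / a..- 1 / b} x) \<partial>lborel)"
        by (rule nn_integral_cong) (simp add: K split: split_indicator)
      finally show ?thesis .
    qed
    also have "\<dots> = (\<integral>\<^sup>+x. ennreal (indicator A (- 1 / x) * (1 / x\<^sup>2) * indicator {a..b} x) \<partial>lborel)"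
    proof (rule nn_integral_substitution)
      show "set_borel_measurable borel {- 1 / a..- 1 / b} (indicator A :: real \<Rightarrow> real)"
        unfolding set_borel_measurable_def by measurable
      show "((\<lambda>x. - 1 / x) has_real_derivative 1 / x\<^sup>2) (at x)" if "x \<in> {a..b}" for x
        using that ab by (auto intro!: derivative_eq_intros simp: power2_eq_square)
      show "continuous_on {a..b} (\<lambda>x. 1 / x\<^sup>2)" using ab by (intro continuous_intros) auto
    qed (use ab in auto)
    also have "\<dots> = emeasure N (A \<inter> K n)"
    proof (subst emN)
      show "A \<inter> K n \<in> sets borel" by (simp add: K)
      show "(\<integral>\<^sup>+x. ennreal (indicator A (- 1 / x) * (1 / x\<^sup>2) * indicator {a..b} x) \<partial>lborel)
        = (\<integral>\<^sup>+t. ennreal (1 / t\<^sup>2) * indicator {0<..} t * indicator (A \<inter> K n) (- 1 / t) \<partial>lborel)"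
      proof (rule nn_integral_cong)
        fix t :: real
        have "t \<in> {a..b} \<longleftrightarrow> 0 < t \<and> - 1 / t \<in> K n"
          using ab by (auto simp: K field_simps)
        then show "ennreal (indicator A (- 1 / t) * (1 / t\<^sup>2) * indicator {a..b} t)
            = ennreal (1 / t\<^sup>2) * indicator {0<..} t * indicator (A \<inter> K n) (- 1 / t)"
          by (auto split: split_indicator)
      qed
    qed
    finally show ?thesis .
  qed
  have inc: "incseq (\<lambda>n. A \<inter> K n)"
  proof (rule incseq_SucI)
    fix n
    have "1 / real (Suc (Suc n)) \<le> 1 / real (Suc n)" by (intro frac_le) auto
    then show "A \<inter> K n \<subseteq> A \<inter> K (Suc n)" unfolding K_def by auto
  qed
  have UN: "(\<Union>n. A \<inter> K n) = A \<inter> {..<0}"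
  proof (intro equalityI subsetI)
    fix x assume x: "x \<in> A \<inter> {..<0}"
    obtain n where n: "max (- x) (1 / (- x)) \<le> real n" using real_arch_simple by blast
    have "1 \<le> real n * (- x)" using n x by (simp add: field_simps)
    also have "\<dots> \<le> real (Suc n) * (- x)" using x by (intro mult_right_mono) auto
    finally have "x \<le> - 1 / real (Suc n)" by (simp add: field_simps)
    moreover have "- real (Suc n) \<le> x" using n by simp
    ultimately show "x \<in> (\<Union>n. A \<inter> K n)" using x unfolding K_def by (metis Int_iff UN_I UNIV_I atLeastAtMost_iff)
  next
    fix x assume "x \<in> (\<Union>n. A \<inter> K n)"
    then obtain n where "x \<in> A" "x \<le> - 1 / real (Suc n)" by (auto simp: K_def)
    moreover have "- 1 / real (Suc n) < 0" by (simp add: field_simps)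
    ultimately show "x \<in> A \<inter> {..<0}" by (simp only: Int_iff lessThan_iff) (metis order_le_less_trans)
  qed
  have 1: "(\<lambda>n. emeasure lborel (A \<inter> K n)) \<longlonglongrightarrow> emeasure lborel (\<Union>n. A \<inter> K n)"
    by (intro Lim_emeasure_incseq inc) (auto simp: K_def)
  have 2: "(\<lambda>n. emeasure N (A \<inter> K n)) \<longlonglongrightarrow> emeasure N (\<Union>n. A \<inter> K n)"
    by (intro Lim_emeasure_incseq inc) (auto simp: K_def N_def)
  have "emeasure lborel (A \<inter> {..<0}) = emeasure N (A \<inter> {..<0})"
    by (rule LIMSEQ_unique[OF 1[unfolded step UN] 2[unfolded UN]])
  also have "\<dots> = (\<integral>\<^sup>+t. ennreal (1 / t\<^sup>2) * indicator {0<..} t * indicator A (- 1 / t) \<partial>lborel)"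
    by (subst emN) (auto intro!: nn_integral_cong split: split_indicator)
  finally show ?thesis .
qed

lemma nn_integral_inversion_real:
  fixes f :: "real \<Rightarrow> ennreal"
  assumes [measurable]: "f \<in> borel_measurable borel"
  shows "(\<integral>\<^sup>+t. f t \<partial>lborel) = (\<integral>\<^sup>+t. f (1 / t) * ennreal (1 / t\<^sup>2) \<partial>lborel)"
proof -
  define N where "N = distr (density lborel (\<lambda>t::real. ennreal (1 / t\<^sup>2))) lborel (\<lambda>t. 1 / t)"
  have "lborel = N"
  proof (rule measure_eqI)
    fix A :: "real set" assume "A \<in> sets lborel"
    then have [measurable]: "A \<in> sets borel" by simp
    let ?w = "\<lambda>t::real. ennreal (1 / t\<^sup>2)"
    have [measurable]: "uminus -` A \<in> sets borel"
      using measurable_sets[of "uminus :: real \<Rightarrow> real" borel borel A] by simp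
    have neg: "emeasure lborel (A \<inter> {..<0}) = (\<integral>\<^sup>+t. ?w t * indicator {..<0} t * indicator A (1 / t) \<partial>lborel)"
      unfolding emeasure_negative_inversion[OF \<open>A \<in> sets borel\<close>]
      by (subst nn_integral_uminus_real) (auto intro!: nn_integral_cong split: split_indicator)
    have "emeasure lborel (A \<inter> {0<..}) = (\<integral>\<^sup>+t. indicator (A \<inter> {0<..}) t \<partial>lborel)" by simp
    also have "\<dots> = (\<integral>\<^sup>+t. indicator (A \<inter> {0<..}) (- t) \<partial>lborel)"
      by (rule nn_integral_uminus_real) simp
    also have "\<dots> = (\<integral>\<^sup>+t. indicator (uminus -` A \<inter> {..<0}) t \<partial>lborel)"
      by (rule nn_integral_cong) (simp split: split_indicator)
    also have "\<dots> = emeasure lborel (uminus -` A \<inter> {..<0})" by (intro nn_integral_indicator) simp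
    also have "\<dots> = (\<integral>\<^sup>+t. ?w t * indicator {0<..} t * indicator A (1 / t) \<partial>lborel)"
      by (subst emeasure_negative_inversion) (auto intro!: nn_integral_cong split: split_indicator)
    finally have pos: "emeasure lborel (A \<inter> {0<..}) = (\<integral>\<^sup>+t. ?w t * indicator {0<..} t * indicator A (1 / t) \<partial>lborel)" .
    have "emeasure lborel A = emeasure lborel (A \<inter> {..<0} \<union> A \<inter> {0<..})"
    proof (rule emeasure_eq_AE)
      show "AE x in lborel. x \<in> A \<longleftrightarrow> x \<in> A \<inter> {..<0} \<union> A \<inter> {0<..}"
        using AE_lborel_singleton[of 0] by eventually_elim auto
    qed auto
    also have "\<dots> = emeasure lborel (A \<inter> {..<0}) + emeasure lborel (A \<inter> {0<..})"
      by (intro plus_emeasure[symmetric]) auto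
    also have "\<dots> = (\<integral>\<^sup>+t. ?w t * indicator {..<0} t * indicator A (1 / t) + ?w t * indicator {0<..} t * indicator A (1 / t) \<partial>lborel)"
      unfolding neg pos by (intro nn_integral_add[symmetric]) auto
    also have "\<dots> = (\<integral>\<^sup>+t. ?w t * indicator A (1 / t) \<partial>lborel)"
      by (intro nn_integral_cong) (auto split: split_indicator)
    also have "\<dots> = (\<integral>\<^sup>+t. indicator A t \<partial>N)"
      unfolding N_def by (subst nn_integral_distr) (simp_all add: nn_integral_density)
    also have "\<dots> = emeasure N A" by (simp add: N_def)
    finally show "emeasure lborel A = emeasure N A" .
  qed (simp add: N_def)
  then have "(\<integral>\<^sup>+t. f t \<partial>lborel) = (\<integral>\<^sup>+t. f t \<partial>N)" by simp
  also have "\<dots> = (\<integral>\<^sup>+t. f (1 / t) * ennreal (1 / t\<^sup>2) \<partial>lborel)"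
    unfolding N_def by (subst nn_integral_distr) (auto simp: nn_integral_density mult.commute)
  finally show ?thesis .
qed

lemma nn_integral_sign_real:
  fixes f :: "real \<Rightarrow> ennreal"
  assumes [measurable]: "f \<in> borel_measurable borel" and "e = 1 \<or> e = -1"
  shows "(\<integral>\<^sup>+x. f x \<partial>lborel) = (\<integral>\<^sup>+x. f (e * x) \<partial>lborel)"
  using assms(2) nn_integral_uminus_real[OF assms(1)] by auto

text \<open>The value is \<open>0\<close> where \<open>1 + x y = 0\<close>, so this is a density on the whole plane, and the substitutions below
  need not keep track of domains.\<close>

definition cf_weight :: "real \<times> real \<Rightarrow> ennreal" where
  "cf_weight p = ennreal (1 / (1 + fst p * snd p)\<^sup>2)"

lemma cf_weight_measurable [measurable]: "cf_weight \<in> borel_measurable borel"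
  unfolding cf_weight_def borel_prod[symmetric] by measurable

text \<open>With \<open>t = - 1 / y\<close> the branch is the Moebius transformation \<open>e / s - d\<close> in both coordinates \<open>s = x\<close>
  and \<open>s = t\<close>, and its inverse is \<open>e / (d + s)\<close>.\<close>

definition branch_inv :: "real \<Rightarrow> real \<Rightarrow> real \<times> real \<Rightarrow> real \<times> real" where
  "branch_inv d e p = (e / (d + fst p), e * (1 / snd p - d))"

definition branch :: "real \<Rightarrow> real \<Rightarrow> real \<times> real \<Rightarrow> real \<times> real" where
  "branch d e p = (e / fst p - d, 1 / (d + e * snd p))"

lemma branch_measurable [measurable]:
  "branch d e \<in> borel_measurable borel" "branch_inv d e \<in> borel_measurable borel"
  unfolding branch_def branch_inv_def borel_prod[symmetric] by measurable

text \<open>Both coordinates are changed separately, by an inversion combined with isometries of the line. The two Jacobians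
  \<open>1 / (d + x)\<^sup>2\<close> and \<open>1 / y\<^sup>2\<close> are absorbed by the weight, because
  \<open>1 + x' y' = (1 + x y) / (y (d + x))\<close> for the image \<open>(x', y')\<close> of \<open>(x, y)\<close> under
  \<open>branch_inv d e\<close>.\<close>

lemma nn_integral_branch_inv:
  fixes G :: "real \<times> real \<Rightarrow> ennreal"
  assumes G: "G \<in> borel_measurable borel" and e: "e = 1 \<or> e = -1"
  shows "(\<integral>\<^sup>+p. G p * cf_weight p \<partial>lborel) = (\<integral>\<^sup>+p. G (branch_inv d e p) * cf_weight p \<partial>lborel)"
proof -
  have [measurable]: "G \<in> borel_measurable (borel \<Otimes>\<^sub>M borel)" using G by (simp add: borel_prod)
  have [measurable]: "cf_weight \<in> borel_measurable (borel \<Otimes>\<^sub>M borel)" by (simp add: borel_prod)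
  have [measurable]: "branch_inv d e \<in> measurable (borel \<Otimes>\<^sub>M borel) (borel \<Otimes>\<^sub>M borel)" by (simp add: borel_prod)
  define F where "F = (\<lambda>p. G p * cf_weight p)"
  have [measurable]: "F \<in> borel_measurable (borel \<Otimes>\<^sub>M borel)" by (simp add: F_def)
  have first: "(\<integral>\<^sup>+x. f x \<partial>lborel) = (\<integral>\<^sup>+x. f (e / (d + x)) * ennreal (1 / (d + x)\<^sup>2) \<partial>lborel)"
    if [measurable]: "f \<in> borel_measurable borel" for f
  proof -
    have "(\<integral>\<^sup>+x. f x \<partial>lborel) = (\<integral>\<^sup>+x. f (e * x) \<partial>lborel)" by (intro nn_integral_sign_real that e)
    also have "\<dots> = (\<integral>\<^sup>+x. f (e * (1 / x)) * ennreal (1 / x\<^sup>2) \<partial>lborel)" by (rule nn_integral_inversion_real) simp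
    also have "\<dots> = (\<integral>\<^sup>+x. f (e * (1 / (d + x))) * ennreal (1 / (d + x)\<^sup>2) \<partial>lborel)"
      by (rule nn_integral_shift_real) simp
    finally show ?thesis by simp
  qed
  have second: "(\<integral>\<^sup>+y. f y \<partial>lborel) = (\<integral>\<^sup>+y. f (e * (1 / y - d)) * ennreal (1 / y\<^sup>2) \<partial>lborel)"
    if [measurable]: "f \<in> borel_measurable borel" for f
  proof -
    have "(\<integral>\<^sup>+x. f x \<partial>lborel) = (\<integral>\<^sup>+x. f (e * x) \<partial>lborel)" by (intro nn_integral_sign_real that e)
    also have "\<dots> = (\<integral>\<^sup>+x. f (e * (- d + x)) \<partial>lborel)" by (rule nn_integral_shift_real) simp
    also have "\<dots> = (\<integral>\<^sup>+x. f (e * (- d + 1 / x)) * ennreal (1 / x\<^sup>2) \<partial>lborel)"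
      by (rule nn_integral_inversion_real) simp
    finally show ?thesis by simp
  qed
  have weight: "cf_weight (branch_inv d e (x, y)) * ennreal (1 / y\<^sup>2) * ennreal (1 / (d + x)\<^sup>2) = cf_weight (x, y)"
    if "x \<noteq> - d" "y \<noteq> 0" for x y
  proof -
    have nz: "d + x \<noteq> 0" using that by auto
    have ee: "e * e = 1" using e by auto
    have "1 + e / (d + x) * (e * (1 / y - d)) = 1 + (e * e) * (1 / y - d) / (d + x)" by simp
    also have "\<dots> = (1 + x * y) / (y * (d + x))"
    proof -
      have "1 + (1 / y - d) / s = (1 + (s - d) * y) / (y * s)" if "s \<noteq> 0" for s
        using that \<open>y \<noteq> 0\<close> by (simp add: field_simps)
      from this[OF nz] show ?thesis by (simp add: ee)
    qed
    finally have "1 / (1 + e / (d + x) * (e * (1 / y - d)))\<^sup>2 * (1 / y\<^sup>2) * (1 / (d + x)\<^sup>2) = 1 / (1 + x * y)\<^sup>2"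
      using nz that by (simp add: power_divide power_mult_distrib)
    then show ?thesis unfolding cf_weight_def branch_inv_def
      by (simp flip: ennreal_mult)
  qed
  have "(\<integral>\<^sup>+p. F p \<partial>lborel) = (\<integral>\<^sup>+x. \<integral>\<^sup>+y. F (x, y) \<partial>lborel \<partial>lborel)"
    by (simp add: lborel_prod[symmetric] lborel.nn_integral_fst)
  also have "\<dots> = (\<integral>\<^sup>+x. (\<integral>\<^sup>+y. F (e / (d + x), y) \<partial>lborel) * ennreal (1 / (d + x)\<^sup>2) \<partial>lborel)"
    by (rule first) measurable
  also have "\<dots> = (\<integral>\<^sup>+x. \<integral>\<^sup>+y. G (branch_inv d e (x, y)) * cf_weight (x, y) \<partial>lborel \<partial>lborel)"
  proof (rule nn_integral_cong_AE)
    show "AE x in lborel. (\<integral>\<^sup>+y. F (e / (d + x), y) \<partial>lborel) * ennreal (1 / (d + x)\<^sup>2)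
      = (\<integral>\<^sup>+y. G (branch_inv d e (x, y)) * cf_weight (x, y) \<partial>lborel)"
      using AE_lborel_singleton[of "- d"]
    proof eventually_elim
      fix x :: real assume x: "x \<noteq> - d"
      have "(\<integral>\<^sup>+y. F (e / (d + x), y) \<partial>lborel) * ennreal (1 / (d + x)\<^sup>2)
        = (\<integral>\<^sup>+y. F (e / (d + x), e * (1 / y - d)) * ennreal (1 / y\<^sup>2) \<partial>lborel) * ennreal (1 / (d + x)\<^sup>2)"
        by (subst second) (auto)
      also have "\<dots> = (\<integral>\<^sup>+y. F (e / (d + x), e * (1 / y - d)) * ennreal (1 / y\<^sup>2) * ennreal (1 / (d + x)\<^sup>2) \<partial>lborel)"
        by (intro nn_integral_multc[symmetric]) measurable
      also have "\<dots> = (\<integral>\<^sup>+y. G (branch_inv d e (x, y)) * cf_weight (x, y) \<partial>lborel)"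
      proof (rule nn_integral_cong_AE)
        show "AE y in lborel. F (e / (d + x), e * (1 / y - d)) * ennreal (1 / y\<^sup>2) * ennreal (1 / (d + x)\<^sup>2)
            = G (branch_inv d e (x, y)) * cf_weight (x, y)"
          using AE_lborel_singleton[of 0]
          by eventually_elim (simp add: weight[OF x, symmetric] F_def branch_inv_def mult_ac)
      qed
      finally show "(\<integral>\<^sup>+y. F (e / (d + x), y) \<partial>lborel) * ennreal (1 / (d + x)\<^sup>2)
        = (\<integral>\<^sup>+y. G (branch_inv d e (x, y)) * cf_weight (x, y) \<partial>lborel)" .
    qed
  qed
  also have "\<dots> = (\<integral>\<^sup>+p. G (branch_inv d e p) * cf_weight p \<partial>lborel)"
    unfolding lborel_prod[symmetric] by (rule lborel.nn_integral_fst) measurable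
  finally show ?thesis by (simp add: F_def)
qed

section \<open>Contraction of the vertical fibres\<close>

locale alpha_cf =
  fixes \<alpha> :: real
  assumes alpha_pos: "0 < \<alpha>" and alpha_le_1: "\<alpha> \<le> 1"
begin

lemma cf_map_nonzero:
  assumes "x \<noteq> 0"
  shows "cf_map \<alpha> x = eps x / x - of_int (digit \<alpha> x)"
  using assms by (auto simp: cf_map_def eps_def abs_if)

lemma cf_map_bounds: "x \<noteq> 0 \<Longrightarrow> \<alpha> - 1 \<le> cf_map \<alpha> x \<and> cf_map \<alpha> x < \<alpha>"
  unfolding cf_map_def digit_def by (simp; linarith)

lemma cf_map_half_open: "\<alpha> - 1 \<le> cf_map \<alpha> x" "cf_map \<alpha> x < \<alpha>"
  using cf_map_bounds[of x] alpha_pos alpha_le_1 by (cases "x = 0"; simp add: cf_map_def)+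

lemma eps_cases: "eps x = 1 \<or> eps x = -1" by (simp add: eps_def)

lemma digit_ge:
  assumes "x \<in> Ival \<alpha>" "x \<noteq> 0"
  shows "1 \<le> digit \<alpha> x" "x < 0 \<Longrightarrow> 2 \<le> digit \<alpha> x"
proof -
  have x: "\<alpha> - 1 \<le> x" "x \<le> \<alpha>" using assms by (auto simp: Ival_def)
  show *: "2 \<le> digit \<alpha> x" if "x < 0"
  proof -
    define s where "s = 1 - \<alpha>"
    have s: "0 < s" "- x \<le> s" "0 < - x" using that x by (auto simp: s_def)
    have "1 / s \<le> 1 / (- x)" using s by (intro frac_le) auto
    moreover have "2 \<le> 1 / s + s"
    proof -
      have "0 \<le> (s - 1)\<^sup>2 / s" using s by simp
      also have "(s - 1)\<^sup>2 / s = 1 / s + s - 2" using s by (simp add: field_simps power2_eq_square)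
      finally show ?thesis by simp
    qed
    moreover have "\<bar>1 / x\<bar> = 1 / (- x)" using s by (simp add: abs_if)
    ultimately show ?thesis unfolding digit_def s_def by (simp add: le_floor_iff)
  qed
  show "1 \<le> digit \<alpha> x"
  proof (cases "x < 0")
    case True then show ?thesis using * by simp
  next
    case False
    then have "0 < x" using assms by simp
    then have "1 / \<alpha> \<le> 1 / x" using x by (intro divide_left_mono) auto
    moreover have "1 \<le> 1 / \<alpha>" using alpha_pos alpha_le_1 by simp
    ultimately show ?thesis using \<open>0 < x\<close> alpha_le_1 unfolding digit_def by (simp add: le_floor_iff)
  qed
qed

lemma denominator_ge_1:
  assumes "x \<in> Ival \<alpha>" "x \<noteq> 0" "0 \<le> y" "y \<le> 1"
  shows "1 \<le> of_int (digit \<alpha> x) + eps x * y"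
proof (cases "x < 0")
  case True
  then have "(2::real) \<le> of_int (digit \<alpha> x)" using digit_ge(2)[of x] assms by linarith
  then show ?thesis using True assms by (simp add: eps_def)
next
  case False
  then have "(1::real) \<le> of_int (digit \<alpha> x)" using digit_ge(1)[of x] assms by linarith
  then show ?thesis using False assms by (simp add: eps_def)
qed

lemma one_plus_xy_ge:
  assumes "\<alpha> - 1 \<le> x" "0 \<le> y" "y \<le> 1"
  shows "\<alpha> \<le> 1 + x * y"
proof (cases "x \<ge> 0")
  case True then show ?thesis using assms alpha_le_1 mult_nonneg_nonneg[of x y] by linarith
next
  case False
  then have "x * 1 \<le> x * y" using assms by (intro mult_left_mono_neg) auto
  then show ?thesis using assms by simp
qed

text \<open>The interval between \<open>s\<close> and \<open>t\<close> is shortened by the product of the two denominators. One of them is at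
  least \<open>1\<close>, the other at least \<open>1 + (t - s)\<close>: the one at \<open>t\<close> if \<open>e = 1\<close>, the one at \<open>s\<close> if
  \<open>e = - 1\<close>. There is no uniform rate below \<open>1\<close>, as the branches \<open>1 / (1 + y)\<close> and \<open>1 / (2 - y)\<close> have
  points of derivative \<open>\<plusminus>1\<close>; but the map \<open>L \<mapsto> L / (1 + L)\<close> sends \<open>1 / n\<close> to \<open>1 / (n + 1)\<close>.\<close>

lemma fibre_step_contracts:
  fixes d e s t L :: real
  assumes "e = 1 \<and> 1 \<le> d \<or> e = -1 \<and> 2 \<le> d" "0 \<le> s" "s \<le> t" "t \<le> 1" "t - s \<le> L"
  shows "\<bar>1 / (d + e * s) - 1 / (d + e * t)\<bar> \<le> L / (1 + L)"
proof -
  have L: "0 \<le> L" using assms by linarith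
  define P where "P = d + e * s"
  define R where "R = d + e * t"
  have 1: "1 \<le> P" "1 \<le> R" using assms by (auto simp: P_def R_def)
  have 2: "1 + (t - s) \<le> P * R"
  proof (cases "e = 1")
    case True
    then have "1 + (t - s) \<le> R" using assms by (auto simp: R_def)
    then show ?thesis using 1 mult_right_mono[of 1 P R] by linarith
  next
    case False
    then have "1 + (t - s) \<le> P" using assms by (auto simp: P_def)
    then show ?thesis using 1 mult_left_mono[of 1 R P] by linarith
  qed
  have "1 / P - 1 / R = e * (t - s) / (P * R)"
    using 1 by (simp add: field_simps P_def R_def)
  then have "\<bar>1 / P - 1 / R\<bar> = (t - s) / (P * R)"
    using 1 assms by (auto simp: abs_mult)
  also have "\<dots> \<le> (t - s) / (1 + (t - s))"
    using 2 1 assms by (intro divide_left_mono) auto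
  also have "\<dots> \<le> L / (1 + L)"
    using L assms by (simp add: divide_simps) (simp add: algebra_simps)
  finally show ?thesis by (simp add: P_def R_def)
qed

lemma planar_map_pair:
  "planar_map \<alpha> (x, y) = (cf_map \<alpha> x, if x = 0 then 0 else 1 / (of_int (digit \<alpha> x) + eps x * y))"
  by (simp add: planar_map_def)

lemma fst_planar_map: "fst (planar_map \<alpha> p) = cf_map \<alpha> (fst p)"
  by (cases p) (simp add: planar_map_pair)

lemma fst_planar_map_iter: "fst ((planar_map \<alpha> ^^ n) p) = (cf_map \<alpha> ^^ n) (fst p)"
  by (induction n) (simp_all add: fst_planar_map)

lemma planar_map_iter_in:
  assumes "p \<in> Ival \<alpha> \<times> {0..1}"
  shows "(planar_map \<alpha> ^^ n) p \<in> Ival \<alpha> \<times> {0..1}"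
  using assms by (induction n) (use planar_map_in[OF alpha_pos alpha_le_1] in auto)

lemma fibre_contraction:
  assumes x: "x \<in> Ival \<alpha>" and y: "y \<in> {0..1}" and z: "z \<in> {0..1}"
  shows "\<bar>snd ((planar_map \<alpha> ^^ n) (x, y)) - snd ((planar_map \<alpha> ^^ n) (x, z))\<bar> \<le> 1 / (1 + real n)"
proof (induction n)
  case 0
  then show ?case using y z by auto
next
  case (Suc n)
  define p q where "p = (planar_map \<alpha> ^^ n) (x, y)" and "q = (planar_map \<alpha> ^^ n) (x, z)"
  have pq: "p \<in> Ival \<alpha> \<times> {0..1}" "q \<in> Ival \<alpha> \<times> {0..1}" "fst p = fst q"
    using planar_map_iter_in x y z by (auto simp: p_def q_def fst_planar_map_iter)
  obtain u s t where st: "p = (u, s)" "q = (u, t)" using pq(3) by (cases p; cases q) auto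
  have b: "u \<in> Ival \<alpha>" "0 \<le> s" "s \<le> 1" "0 \<le> t" "t \<le> 1" "\<bar>s - t\<bar> \<le> 1 / (1 + real n)"
    using pq Suc st unfolding p_def[symmetric] q_def[symmetric] by auto
  have g: "\<bar>snd (planar_map \<alpha> (u, s)) - snd (planar_map \<alpha> (u, t))\<bar> \<le> 1 / (1 + real (Suc n))"
  proof (cases "u = 0")
    case True then show ?thesis by (simp add: planar_map_pair)
  next
    case False
    define d where "d = real_of_int (digit \<alpha> u)"
    have "1 \<le> digit \<alpha> u" "u < 0 \<Longrightarrow> 2 \<le> digit \<alpha> u" using digit_ge False b(1) by auto
    then have de: "eps u = 1 \<and> 1 \<le> d \<or> eps u = -1 \<and> 2 \<le> d"
      unfolding eps_def d_def by (cases "u < 0") auto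
    have "\<bar>1 / (d + eps u * s) - 1 / (d + eps u * t)\<bar> \<le> (1 / (1 + real n)) / (1 + 1 / (1 + real n))"
    proof (cases "s \<le> t")
      case True
      then show ?thesis using b by (intro fibre_step_contracts de) auto
    next
      case False
      then have "\<bar>1 / (d + eps u * t) - 1 / (d + eps u * s)\<bar> \<le> (1 / (1 + real n)) / (1 + 1 / (1 + real n))"
        using b by (intro fibre_step_contracts de) auto
      then show ?thesis by (simp add: abs_minus_commute)
    qed
    also have "\<dots> = 1 / (1 + real (Suc n))" by (simp add: field_simps)
    finally show ?thesis using False by (simp add: planar_map_pair d_def)
  qed
  then show ?case by (simp add: p_def[symmetric] q_def[symmetric] st)
qed

section \<open>A rectangle inside Omega\<close>

lemma le_of_mult_le:
  fixes u v k :: real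
  assumes "u * v \<le> k" "1 \<le> u" "0 \<le> v"
  shows "v \<le> k"
  using mult_right_mono[OF assms(2,3)] assms(1) by simp

lemma one_plus_fraction:
  fixes d u v :: real
  assumes "d + u \<noteq> 0"
  shows "1 + (v - d) / (d + u) = (u + v) / (d + u)"
  using assms by (simp add: field_simps)

text \<open>The rational number \<open>A / C\<close> stands for the cusp that the point \<open>(x, y)\<close> is to reach, and the branch at
  \<open>x\<close> moves it to \<open>A' / A\<close>. The quantity \<open>C\<^sup>2 |x - A / C| (1 + (A / C) y) / (1 + x y)\<close> is invariant under
  the branches; it is the distance of \<open>x\<close> and \<open>A / C\<close> in units of the denominator, up to a factor that
  is bounded as long as \<open>A / C\<close> is not much below \<open>\<alpha> - 1\<close>. The distance itself is at most
  doubled by one step, and a distance of \<open>2 \<kappa>\<close> still keeps that factor under control, so the invariant brings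
  it back below \<open>\<kappa>\<close>. The value of \<open>Q\<close> is the one for which this closes up.
  The new fraction \<open>A' / A\<close> is then close to the interval again. Hence \<open>|A'| \<le> |A| \<le> |C|\<close>, and the sum of
  the absolute values of numerator and denominator drops.\<close>

lemma cusp_step:
  fixes A C :: int and x y :: real
  defines "\<kappa> \<equiv> \<alpha> / 8" and "Q \<equiv> \<alpha>\<^sup>2 / 32"
  assumes x: "\<alpha> - 1 \<le> x" "x < \<alpha>" and y: "0 \<le> y" "y \<le> 1"
    and C: "C \<noteq> 0" and A: "A \<noteq> 0"
    and near: "\<bar>of_int C\<bar> * \<bar>of_int C * x - of_int A\<bar> \<le> \<kappa>"
    and inv: "\<bar>of_int C\<bar> * \<bar>of_int C * x - of_int A\<bar> * (1 + of_int A / of_int C * y) \<le> Q * (1 + x * y)"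
  defines "A' \<equiv> (if x \<ge> 0 then C else - C) - digit \<alpha> x * A"
    and "x' \<equiv> cf_map \<alpha> x" and "y' \<equiv> 1 / (of_int (digit \<alpha> x) + eps x * y)"
  shows "x \<noteq> 0"
    and "\<bar>of_int A\<bar> * \<bar>of_int A * x' - of_int A'\<bar> \<le> \<kappa>"
    and "\<bar>of_int A\<bar> * \<bar>of_int A * x' - of_int A'\<bar> * (1 + of_int A' / of_int A * y') \<le> Q * (1 + x' * y')"
    and "\<bar>A'\<bar> + \<bar>A\<bar> < \<bar>A\<bar> + \<bar>C\<bar>"
proof -
  define c where "c = real_of_int C"
  define a where "a = real_of_int A"
  define d where "d = real_of_int (digit \<alpha> x)"
  define e where "e = eps x"
  define a' where "a' = real_of_int A'"
  have kap: "0 < \<kappa>" "\<kappa> \<le> 1 / 8" "\<kappa> < \<alpha>" using alpha_pos alpha_le_1 by (auto simp: \<kappa>_def)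
  have c1: "1 \<le> \<bar>c\<bar>" and a1: "1 \<le> \<bar>a\<bar>" using C A by (auto simp: c_def a_def)
  have near: "\<bar>c\<bar> * \<bar>c * x - a\<bar> \<le> \<kappa>" using near by (simp add: c_def a_def)
  have near1: "\<bar>c * x - a\<bar> \<le> \<kappa>"
    using le_of_mult_le[OF near c1] by simp
  have cx: "\<bar>a\<bar> - \<kappa> \<le> \<bar>c\<bar> * \<bar>x\<bar>" using near1 by (simp add: abs_mult[symmetric])
  have cxpos: "0 < \<bar>c\<bar> * \<bar>x\<bar>" using cx kap a1 by linarith
  then show x0: "x \<noteq> 0" by auto
  have xI: "x \<in> Ival \<alpha>" using x by (simp add: Ival_def)
  have e: "e = 1 \<or> e = -1" "e * x = \<bar>x\<bar>" "e * e = 1" by (auto simp: e_def eps_def)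
  have x': "x' = e / x - d" using cf_map_nonzero[OF x0] by (simp add: x'_def e_def d_def)
  have x'b: "\<alpha> - 1 \<le> x'" "x' < \<alpha>" using cf_map_bounds[OF x0] by (auto simp: x'_def)
  have a': "a' = e * c - d * a" by (simp add: a'_def A'_def e_def eps_def c_def d_def a_def)
  have den: "1 \<le> d + e * y" using denominator_ge_1[OF xI x0 y] by (simp add: d_def e_def)
  have y': "y' = 1 / (d + e * y)" by (simp add: y'_def d_def e_def)
  have y'b: "0 \<le> y'" "y' \<le> 1" using den by (auto simp: y')
  have e1: "a * x' - a' = e * (a - c * x) / x" using x0 by (simp add: x' a' field_simps)
  then have e2: "\<bar>a * x' - a'\<bar> = \<bar>c * x - a\<bar> / \<bar>x\<bar>"
    using e(1) by (auto simp: abs_mult abs_minus_commute)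
  have ax: "\<bar>a\<bar> / \<bar>x\<bar> \<le> 2 * \<bar>c\<bar>"
  proof -
    have "\<bar>a\<bar> \<le> 2 * (\<bar>c\<bar> * \<bar>x\<bar>)" using cx a1 kap by linarith
    then show ?thesis using x0 by (simp add: field_simps)
  qed
  have n2: "\<bar>a\<bar> * \<bar>a * x' - a'\<bar> \<le> 2 * \<kappa>"
  proof -
    have "\<bar>a\<bar> * \<bar>a * x' - a'\<bar> = \<bar>a\<bar> / \<bar>x\<bar> * \<bar>c * x - a\<bar>" by (simp add: e2)
    also have "\<dots> \<le> 2 * \<bar>c\<bar> * \<bar>c * x - a\<bar>" using ax by (intro mult_right_mono) auto
    finally show ?thesis using near by simp
  qed
  \<comment> \<open>The cusp cannot sit on the other side of \<open>0\<close>, so its sign is that of \<open>x\<close>.\<close>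
  have sgn: "0 < e * (a / c)"
  proof (rule ccontr)
    assume neg: "\<not> ?thesis"
    have c0: "c \<noteq> 0" using c1 by auto
    have "e * (c * x - a) / c = \<bar>x\<bar> - e * (a / c)" using e(2) c0 by (simp add: field_simps)
    then have "\<bar>a / c\<bar> \<le> \<bar>e * (c * x - a) / c\<bar>" using neg e(1) by auto
    also have "\<dots> = \<bar>c * x - a\<bar> / \<bar>c\<bar>" using e(1) by (auto simp: abs_mult)
    finally have "\<bar>a\<bar> \<le> \<bar>c * x - a\<bar>" using c0 by (simp add: abs_divide field_simps)
    then show False using near1 a1 kap by linarith
  qed
  have r: "e * c / a = \<bar>c\<bar> / \<bar>a\<bar>"
  proof -
    have "0 < e * c / a" using sgn e(1) by (auto simp: zero_less_divide_iff divide_less_0_iff)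
    then have "e * c / a = \<bar>e * c / a\<bar>" by (rule abs_of_pos[symmetric])
    also have "\<dots> = \<bar>c\<bar> / \<bar>a\<bar>" using e(1) by (auto simp: abs_mult)
    finally show ?thesis .
  qed
  have e3: "1 + a' / a * y' = (1 + a / c * y) * (\<bar>c\<bar> / \<bar>a\<bar>) / (d + e * y)"
  proof -
    have a0: "a \<noteq> 0" and c0: "c \<noteq> 0" and d0: "d + e * y \<noteq> 0" using a1 c1 den by auto
    have "1 + a' / a * y' = 1 + (\<bar>c\<bar> / \<bar>a\<bar> - d) / (d + e * y)"
      using a0 by (simp add: a' y' r[symmetric] diff_divide_distrib)
    also have "\<dots> = (e * y + \<bar>c\<bar> / \<bar>a\<bar>) / (d + e * y)" using d0 by (simp add: field_simps)
    also have "e * y + \<bar>c\<bar> / \<bar>a\<bar> = (1 + a / c * y) * (\<bar>c\<bar> / \<bar>a\<bar>)"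
      unfolding r[symmetric] using a0 c0 by (simp add: distrib_right add_divide_distrib)
    finally show ?thesis .
  qed
  have e4: "1 + x' * y' = (1 + x * y) / (\<bar>x\<bar> * (d + e * y))"
  proof -
    have d0: "d + e * y \<noteq> 0" using den by auto
    have ex: "e / x = 1 / \<bar>x\<bar>" using x0 by (simp add: e_def eps_def)
    have ey: "e * y = x * y / \<bar>x\<bar>" using x0 by (simp add: e_def eps_def)
    have "1 + x' * y' = 1 + (e / x - d) / (d + e * y)" by (simp add: x' y')
    also have "\<dots> = (e * y + e / x) / (d + e * y)"
      by (rule one_plus_fraction[OF d0])
    also have "e * y + e / x = (1 + x * y) / \<bar>x\<bar>" unfolding ex ey by (simp add: add_divide_distrib)
    finally show ?thesis by (simp only: divide_divide_eq_left)
  qed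
  have inv': "\<bar>a\<bar> * \<bar>a * x' - a'\<bar> * (1 + a' / a * y') \<le> Q * (1 + x' * y')"
  proof -
    have a0: "\<bar>a\<bar> \<noteq> 0" using a1 by auto
    have "\<bar>a\<bar> * \<bar>a * x' - a'\<bar> * (1 + a' / a * y')
        = \<bar>c\<bar> * \<bar>c * x - a\<bar> * (1 + a / c * y) / (\<bar>x\<bar> * (d + e * y))"
      unfolding e2 e3 using a0 by simp
    also have "\<dots> \<le> Q * (1 + x * y) / (\<bar>x\<bar> * (d + e * y))"
      using inv den x0 by (intro divide_right_mono) (auto simp: c_def a_def)
    finally show ?thesis by (simp add: e4)
  qed
  then show "\<bar>of_int A\<bar> * \<bar>of_int A * x' - of_int A'\<bar> * (1 + of_int A' / of_int A * y') \<le> Q * (1 + x' * y')"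
    by (simp add: a_def a'_def)
  have rho: "\<bar>x' - a' / a\<bar> \<le> 2 * \<kappa>"
  proof -
    have "\<bar>x' - a' / a\<bar> = \<bar>a * x' - a'\<bar> / \<bar>a\<bar>"
    proof -
      have "x' - a' / a = (a * x' - a') / a" using a1 by (simp add: diff_divide_distrib)
      then show ?thesis by (simp only: abs_divide)
    qed
    also have "\<dots> \<le> \<bar>a * x' - a'\<bar> / 1" using a1 by (intro divide_left_mono) auto
    also have "\<dots> \<le> \<bar>a\<bar> * \<bar>a * x' - a'\<bar>" using a1 mult_right_mono[of 1 "\<bar>a\<bar>" "\<bar>a * x' - a'\<bar>"] by simp
    also note n2
    finally show ?thesis .
  qed
  \<comment> \<open>The crude bound keeps the new cusp above \<open>\<alpha> - 1 - \<alpha> / 4\<close>.\<close>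
  have low: "\<alpha> / 2 \<le> 1 + a' / a * y'"
  proof (cases "0 \<le> a' / a")
    case True
    then show ?thesis using mult_nonneg_nonneg[OF True y'b(1)] alpha_le_1 by linarith
  next
    case False
    then have "a' / a * 1 \<le> a' / a * y'" using y'b by (intro mult_left_mono_neg) auto
    moreover have "\<alpha> - 1 - 2 * \<kappa> \<le> a' / a" using rho x'b by linarith
    ultimately show ?thesis using alpha_pos by (simp add: \<kappa>_def)
  qed
  have near': "\<bar>a\<bar> * \<bar>a * x' - a'\<bar> \<le> \<kappa>"
  proof -
    have xy1: "x' * y' \<le> 1"
      using mult_right_mono[of x' 1 y'] x'b y'b alpha_le_1 by linarith
    moreover have "\<bar>a\<bar> * \<bar>a * x' - a'\<bar> * (\<alpha> / 2) \<le> \<bar>a\<bar> * \<bar>a * x' - a'\<bar> * (1 + a' / a * y')"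
      using low by (intro mult_left_mono) auto
    moreover have "Q * (1 + x' * y') \<le> Q * 2" using xy1 by (intro mult_left_mono) (auto simp: Q_def)
    ultimately have "\<bar>a\<bar> * \<bar>a * x' - a'\<bar> * (\<alpha> / 2) \<le> Q * 2" using inv' by (meson order_trans)
    then have "\<bar>a\<bar> * \<bar>a * x' - a'\<bar> \<le> Q * 2 / (\<alpha> / 2)" using alpha_pos by (simp add: field_simps)
    also have "\<dots> = \<kappa>" using alpha_pos by (simp add: Q_def \<kappa>_def field_simps power2_eq_square)
    finally show ?thesis .
  qed
  then show "\<bar>of_int A\<bar> * \<bar>of_int A * x' - of_int A'\<bar> \<le> \<kappa>"
    by (simp add: a_def a'_def)
  \<comment> \<open>A fraction this close to the interval has absolute value at most \<open>1\<close>; the value \<open>1\<close> occurs only when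
    \<open>\<alpha>\<close> is close to \<open>1\<close>, and then \<open>x\<close> has digit \<open>1\<close> and the cusp moves to \<open>0\<close>.\<close>
  have mono: "\<bar>S\<bar> \<le> \<bar>T\<bar> \<and> (\<bar>S\<bar> = \<bar>T\<bar> \<longrightarrow> S = T)"
    if "\<alpha> - 1 \<le> X" "X < \<alpha>" "T \<noteq> 0" "\<bar>of_int T\<bar> * \<bar>of_int T * X - of_int S\<bar> \<le> \<kappa>" for S T :: int and X :: real
  proof -
    have T1: "1 \<le> \<bar>real_of_int T\<bar>" using that by simp
    have n: "\<bar>of_int T * X - of_int S\<bar> \<le> \<kappa>"
      using le_of_mult_le[OF that(4) T1] by simp
    have X1: "\<bar>X\<bar> \<le> 1" using that alpha_pos alpha_le_1 by auto
    have "\<bar>real_of_int T\<bar> * \<bar>X\<bar> \<le> \<bar>real_of_int T\<bar> * 1" using X1 by (intro mult_left_mono) auto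
    then have "\<bar>real_of_int S\<bar> \<le> \<bar>real_of_int T\<bar> + \<kappa>" using n abs_mult[of "real_of_int T" X] by linarith
    then have "\<bar>S\<bar> < \<bar>T\<bar> + 1" using kap by linarith
    moreover have "S \<noteq> - T"
    proof
      assume "S = - T"
      then have "\<bar>of_int T * X - of_int S\<bar> = \<bar>real_of_int T\<bar> * \<bar>X + 1\<bar>" by (simp add: abs_mult[symmetric] algebra_simps)
      then have "\<bar>X + 1\<bar> \<le> \<kappa>" using n le_of_mult_le[OF _ T1, of "\<bar>X + 1\<bar>" \<kappa>] by simp
      then show False using that(1) kap by linarith
    qed
    ultimately show ?thesis by auto
  qed
  have m1: "\<bar>A\<bar> \<le> \<bar>C\<bar>" "\<bar>A\<bar> = \<bar>C\<bar> \<Longrightarrow> A = C"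
    using mono[OF x C] near by (auto simp: c_def a_def)
  have m2: "\<bar>A'\<bar> \<le> \<bar>A\<bar>"
    using mono[OF x'b A] near' by (auto simp: a_def a'_def)
  show "\<bar>A'\<bar> + \<bar>A\<bar> < \<bar>A\<bar> + \<bar>C\<bar>"
  proof (cases "A = C")
    case False then show ?thesis using m1 m2 by linarith
  next
    case True
    then have "\<bar>c * x - c\<bar> \<le> \<kappa>" using near1 by (simp add: a_def c_def)
    moreover have "\<bar>c * x - c\<bar> = \<bar>c\<bar> * \<bar>x - 1\<bar>" by (simp add: abs_mult[symmetric] algebra_simps)
    ultimately have "\<bar>x - 1\<bar> \<le> \<kappa>" using le_of_mult_le[OF _ c1, of "\<bar>x - 1\<bar>" \<kappa>] by simp
    then have xl: "7 / 8 \<le> x" using kap by linarith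
    then have "1 / x \<le> 8 / 7" "1 < 1 / x" using x alpha_le_1 by (simp_all add: field_simps)
    moreover have "\<bar>1 / x\<bar> = 1 / x" using xl by simp
    ultimately have "digit \<alpha> x = 1"
      unfolding digit_def using x xl alpha_le_1 by (intro floor_unique) linarith+
    then show ?thesis using True xl C by (simp add: A'_def)
  qed
qed

text \<open>The matrix with rows \<open>A, B\<close> and \<open>C, D\<close> sends \<open>xs\<close> to \<open>x\<close> and \<open>- 1 / ys\<close> to
  \<open>- 1 / y\<close>, and \<open>A / C\<close> is the image of \<open>\<infinity>\<close>. Applying \<open>planar_map \<alpha>\<close> multiplies the matrix
  by that of the branch. The matrix becomes integral affine when \<open>A / C\<close> has reached \<open>0\<close> and one more step
  is made; an integral affine map that respects the range of both coordinates is the identity.\<close>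

lemma orbit_hits_target:
  fixes xs ys x y :: real and A B C D :: int
  defines "\<kappa> \<equiv> \<alpha> / 8" and "Q \<equiv> \<alpha>\<^sup>2 / 32"
  assumes xs: "xs \<notin> \<rat>" "\<alpha> - 1 \<le> xs" "xs < \<alpha>" and ys: "0 < ys" "ys \<le> 1"
    and det: "\<bar>A * D - B * C\<bar> = 1"
    and C: "C \<noteq> 0"
    and x: "\<alpha> - 1 \<le> x" "x < \<alpha>" and y: "0 \<le> y" "y \<le> 1"
    and xeq: "x * (of_int C * xs + of_int D) = of_int A * xs + of_int B"
    and yeq: "y * (of_int B * ys - of_int A) = of_int C - of_int D * ys"
    and yden: "of_int B * ys - of_int A \<noteq> 0"
    and near: "\<bar>of_int C\<bar> * \<bar>of_int C * x - of_int A\<bar> \<le> \<kappa>"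
    and inv: "\<bar>of_int C\<bar> * \<bar>of_int C * x - of_int A\<bar> * (1 + of_int A / of_int C * y) \<le> Q * (1 + x * y)"
  shows "\<exists>n. (planar_map \<alpha> ^^ n) (x, y) = (xs, ys)"
  using assms
proof (induction "nat (\<bar>A\<bar> + \<bar>C\<bar>)" arbitrary: A B C D x y rule: less_induct)
  case less
  define d where "d = digit \<alpha> x"
  define s where "s = (if x \<ge> 0 then 1 else - 1 :: int)"
  define x' where "x' = cf_map \<alpha> x"
  define y' where "y' = 1 / (of_int (digit \<alpha> x) + eps x * y)"
  have s: "of_int s = eps x" "s * s = 1" "s = 1 \<or> s = -1" by (auto simp: s_def eps_def)
  have xI: "x \<in> Ival \<alpha>" using less.prems by (simp add: Ival_def)
  have xnz: "x \<noteq> 0"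
  proof (cases "A = 0")
    case True
    then have "B \<noteq> 0" using less.prems by auto
    then show ?thesis using less.prems(12) True by auto
  next
    case False
    show ?thesis
      by (rule cusp_step(1)) (use less.prems False in \<open>simp_all add: \<kappa>_def Q_def\<close>)
  qed
  have step: "planar_map \<alpha> (x, y) = (x', y')"
    using xnz by (simp add: planar_map_pair x'_def y'_def)
  have x': "x' = of_int s / x - of_int d" using cf_map_nonzero[OF xnz] by (simp add: x'_def s d_def)
  have x'b: "\<alpha> - 1 \<le> x'" "x' < \<alpha>" using cf_map_bounds[OF xnz] by (auto simp: x'_def)
  have den: "1 \<le> of_int d + of_int s * y"
    using denominator_ge_1[OF xI xnz] less.prems by (simp add: d_def s)
  have y': "y' = 1 / (of_int d + of_int s * y)" by (simp add: y'_def d_def s)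
  have y'b: "0 \<le> y'" "y' \<le> 1" using den by (auto simp: y')
  show ?case
  proof (cases "A = 0")
    case A: True
    then have BC: "\<bar>B * C\<bar> = 1" using less.prems by simp
    then have "B dvd 1" "C dvd 1" by (metis abs_dvd_iff dvd_abs_iff dvd_triv_left dvd_triv_right)+
    then have B: "B = 1 \<or> B = -1" and C: "C = 1 \<or> C = -1"
      unfolding zdvd1_eq by linarith+
    define g where "g = s * C * B"
    define m where "m = s * D * B - d"
    have g: "g = 1 \<or> g = -1" using s B C by (auto simp: g_def)
    have bb: "of_int B * of_int B = (1::real)" "B * B = 1" using B by auto
    have xx: "x * (of_int C * xs + of_int D) = of_int B" using less.prems A by simp
    have "1 / x = of_int B * (of_int C * xs + of_int D)"
    proof -
      have "of_int B * (of_int C * xs + of_int D) * x = of_int B * (x * (of_int C * xs + of_int D))"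
        by (simp only: ac_simps)
      also have "\<dots> = 1" unfolding xx by (rule bb(1))
      finally show ?thesis using xnz by (simp add: field_simps)
    qed
    then have x'2: "x' = of_int g * xs + of_int m"
      unfolding x' g_def m_def by (simp add: divide_inverse algebra_simps)
    have y2: "y = (of_int C - of_int D * ys) * of_int B / ys"
    proof -
      have "y * of_int B * ys = of_int C - of_int D * ys" using less.prems A by (simp add: mult.assoc)
      then have "(of_int C - of_int D * ys) * of_int B = y * of_int B * ys * of_int B" by simp
      also have "\<dots> = y * (of_int B * of_int B) * ys" by (simp only: ac_simps)
      finally show ?thesis using ys unfolding bb(1) by simp
    qed
    have "1 / y' = of_int d + of_int s * y" by (simp add: y')
    also have "\<dots> = of_int g / ys - of_int m"
      unfolding y2 g_def m_def using ys by (simp add: field_simps)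
    finally have y'2: "1 / y' = of_int g / ys - of_int m" .
    have y'1: "1 \<le> 1 / y'" using den by (simp add: y')
    \<comment> \<open>The affine map \<open>- xs + m\<close> would need \<open>m \<le> - 1 - 1 / ys\<close> for the height to be admissible, which
      pushes \<open>x'\<close> out of the interval.\<close>
    have gp: "g = 1"
    proof (rule ccontr)
      assume "g \<noteq> 1"
      then have "g = -1" using g by simp
      then have "of_int m \<le> - 1 - 1 / ys" using y'2 y'1 by simp
      moreover have "1 \<le> 1 / ys" using ys by simp
      moreover have "x' \<le> 1 - \<alpha> + of_int m" using x'2 xs \<open>g = -1\<close> by simp
      ultimately show False using x'b alpha_pos alpha_le_1 by linarith
    qed
    have "m = 0" using x'2 x'b xs gp by simp
    then have "x' = xs" "y' = ys" using gp x'2 y'2 by simp_all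
    then have "(planar_map \<alpha> ^^ 1) (x, y) = (xs, ys)" by (simp add: step)
    then show ?thesis ..
  next
    case A: False
    define A' where "A' = s * C - d * A"
    define B' where "B' = s * D - d * B"
    have A'2: "A' = (if x \<ge> 0 then C else - C) - digit \<alpha> x * A" by (simp add: A'_def s_def d_def)

    note st = cusp_step(2-4)[OF less.prems(8-11,7) A less.prems(15,16)[unfolded \<kappa>_def Q_def],
        folded A'2 x'_def y'_def, folded \<kappa>_def Q_def]
    have "\<exists>n. (planar_map \<alpha> ^^ n) (x', y') = (xs, ys)"
    proof (rule less.hyps(1)[where A = A' and B = B' and C = A and D = B])
      show "nat (\<bar>A'\<bar> + \<bar>A\<bar>) < nat (\<bar>A\<bar> + \<bar>C\<bar>)"
        using st(3) by simp
      have "A' * B - B' * A = s * (B * C - A * D)" by (simp add: A'_def B'_def algebra_simps)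
      then show "\<bar>A' * B - B' * A\<bar> = 1" using less.prems s(3) by (auto simp: abs_mult abs_minus_commute mult.commute)
      show "x' * (of_int A * xs + of_int B) = of_int A' * xs + of_int B'"
      proof -
        have "of_int s / x * (of_int A * xs + of_int B) = of_int s * (of_int C * xs + of_int D)"
          using xnz by (simp flip: less.prems(12))
        then show ?thesis by (simp add: x' A'_def B'_def algebra_simps)
      qed
      have e: "of_int B' * ys - of_int A' = - ((of_int B * ys - of_int A) * (of_int d + of_int s * y))"
      proof -
        have "of_int B' * ys - of_int A'
            = - of_int s * (of_int C - of_int D * ys) - of_int d * (of_int B * ys - of_int A)"
          by (simp add: A'_def B'_def algebra_simps)
        then show ?thesis unfolding less.prems(13)[symmetric] by (simp add: algebra_simps)
      qed
      show "of_int B' * ys - of_int A' \<noteq> 0" unfolding e using less.prems den by simp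
      show "y' * (of_int B' * ys - of_int A') = of_int A - of_int B * ys"
        unfolding e y' using den by simp
    qed (rule st less.hyps(2,3) less.prems(1-5) A x'b y'b)+
    then obtain n where "(planar_map \<alpha> ^^ n) (x', y') = (xs, ys)" ..
    then have "(planar_map \<alpha> ^^ Suc n) (x, y) = (xs, ys)" by (simp add: funpow_Suc_right step del: funpow.simps)
    then show ?thesis ..
  qed
qed

definition orbit_set :: "(real \<times> real) set" where
  "orbit_set = {(planar_map \<alpha> ^^ n) (x, 0) | x n. x \<in> {\<alpha> - 1..<\<alpha>}}"

lemma Omega_eq_closure: "Omega \<alpha> = closure orbit_set"
  by (simp add: Omega_def orbit_set_def)

text \<open>The starting point \<open>z\<close> is the image of \<open>xs\<close> under an integral matrix whose lower row \<open>u, v\<close> sends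
  \<open>- 1 / ys = - v / u\<close> to \<open>\<infinity>\<close>; its upper row is determined up to multiples of the lower one, which
  translate \<open>z\<close> by integers. The distance from \<open>z\<close> to the cusp \<open>A / u\<close>, in units of the denominator, is
  \<open>ys / (1 + xs ys)\<close>, hence small for small \<open>ys\<close>.\<close>

lemma small_rational_heights_in_orbit:
  assumes xs: "xs \<notin> \<rat>" "\<alpha> - 1 \<le> xs" "xs < \<alpha>"
    and ys: "ys \<in> \<rat>" "0 < ys" "ys \<le> \<alpha> ^ 3 / 32"
  shows "(xs, ys) \<in> orbit_set"
proof -
  have a1: "\<alpha>\<^sup>2 \<le> \<alpha>" "\<alpha> ^ 3 \<le> \<alpha>"
    using alpha_pos alpha_le_1 power_decreasing[of 1 2 \<alpha>] power_decreasing[of 1 3 \<alpha>] by auto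
  have ys1: "ys \<le> 1" using ys a1 alpha_le_1 by simp
  obtain u v :: int where uv: "v > 0" "coprime u v" "ys = of_int u / of_int v"
    using ys(1) by (elim Rats_cases') auto
  have u: "0 < u" using uv ys(2) by (auto simp: zero_less_divide_iff)
  have "gcd v u = 1" using uv(2) by (simp add: coprime_iff_gcd_eq_1 gcd.commute)
  then obtain A0 B0 where AB: "A0 * v + B0 * u = 1" using bezout_int[of v u] by auto
  define dn where "dn = of_int u * xs + of_int v"
  have dn: "dn = of_int v * (1 + xs * ys)" using uv by (simp add: dn_def field_simps)
  have xy: "\<alpha> \<le> 1 + xs * ys" using one_plus_xy_ge[of xs ys] xs ys ys1 by simp
  have dpos: "0 < dn" unfolding dn using uv xy alpha_pos by simp
  define z0 where "z0 = (of_int A0 * xs - of_int B0) / dn"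
  define k where "k = - \<lfloor>z0 + 1 - \<alpha>\<rfloor>"
  define z where "z = z0 + of_int k"
  have z: "\<alpha> - 1 \<le> z" "z < \<alpha>" unfolding z_def k_def by linarith+
  define A where "A = A0 + k * u"
  define B where "B = - B0 + k * v"
  have det: "A * v - B * u = 1" using AB by (simp add: A_def B_def algebra_simps)
  then have detr: "of_int A * of_int v - of_int B * of_int u = (1::real)"
    by (metis of_int_1 of_int_diff of_int_mult)
  have zeq: "z * dn = of_int A * xs + of_int B"
    using dpos by (simp add: z_def z0_def A_def B_def dn_def field_simps)
  have "of_int u * z - of_int A = (of_int u * (z * dn) - of_int A * dn) / dn"
    using dpos by (simp add: field_simps)
  also have "of_int u * (z * dn) - of_int A * dn = -1"
    unfolding zeq using detr by (simp add: dn_def algebra_simps)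
  finally have "\<bar>of_int u\<bar> * \<bar>of_int u * z - of_int A\<bar> = of_int u / dn" using u dpos by simp
  also have "\<dots> = ys / (1 + xs * ys)" using uv by (simp add: dn)
  also have "\<dots> \<le> (\<alpha> ^ 3 / 32) / \<alpha>" using xy ys alpha_pos by (intro frac_le) auto
  also have "\<dots> = \<alpha>\<^sup>2 / 32" using alpha_pos by (simp add: power2_eq_square power3_eq_cube)
  finally have near: "\<bar>of_int u\<bar> * \<bar>of_int u * z - of_int A\<bar> \<le> \<alpha>\<^sup>2 / 32" .
  have "\<exists>n. (planar_map \<alpha> ^^ n) (z, 0) = (xs, ys)"
  proof (rule orbit_hits_target[where A = A and B = B and C = u and D = v])
    show "z * (of_int u * xs + of_int v) = of_int A * xs + of_int B" using zeq by (simp add: dn_def)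
    show "0 * (of_int B * ys - of_int A) = of_int u - of_int v * ys" using uv by simp
    have "of_int v * (of_int B * ys - of_int A) = - 1" using detr uv by (simp add: algebra_simps)
    then show "of_int B * ys - of_int A \<noteq> 0" by auto
    show "\<bar>of_int u\<bar> * \<bar>of_int u * z - of_int A\<bar> \<le> \<alpha> / 8" using near a1 alpha_pos by linarith
  qed (use xs ys ys1 u z det near in auto)
  then obtain n where "(planar_map \<alpha> ^^ n) (z, 0) = (xs, ys)" ..
  then show ?thesis unfolding orbit_set_def mem_Collect_eq using z
    by (intro exI[of _ z] exI[of _ n]) auto
qed

lemma Omega_contains_rectangle:
  "{\<alpha> - 1<..<\<alpha>} \<times> {0<..<\<alpha> ^ 3 / 32} \<subseteq> Omega \<alpha>"
proof -
  define I J where "I = {\<alpha> - 1<..<\<alpha>}" and "J = {0<..<\<alpha> ^ 3 / 32}"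
  have irr: "closure (- \<rat>) = (UNIV :: real set)"
  proof -
    have "interior (\<rat> :: real set) = {}"
      using open_minus_countable[OF countable_rat, of "interior \<rat>"] interior_subset by blast
    then show ?thesis by (simp add: closure_complement)
  qed
  have "I \<times> J \<subseteq> closure (I \<inter> - \<rat>) \<times> closure (J \<inter> \<rat>)"
    using open_Int_closure_subset[of I "- \<rat>"] open_Int_closure_subset[of J "\<rat>"]
    by (auto simp: irr Rats_closure_real I_def J_def)
  also have "\<dots> = closure ((I \<inter> - \<rat>) \<times> (J \<inter> \<rat>))" by (simp add: closure_Times)
  also have "\<dots> \<subseteq> closure orbit_set"
    by (intro closure_mono) (auto simp: I_def J_def intro!: small_rational_heights_in_orbit)
  finally show ?thesis by (simp add: Omega_eq_closure I_def J_def)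
qed

end

section \<open>Pieces of Omega and their images\<close>

lemma branch_inv_branch:
  assumes "e = 1 \<or> e = -1" "fst p \<noteq> 0" "d + e * snd p \<noteq> 0"
  shows "branch_inv d e (branch d e p) = p"
  using assms by (cases p) (auto simp: branch_def branch_inv_def field_simps)

lemma branch_branch_inv:
  assumes "e = 1 \<or> e = -1" "fst (branch_inv d e q) \<noteq> 0" "d + e * snd (branch_inv d e q) \<noteq> 0"
  shows "branch d e (branch_inv d e q) = q"
  using assms by (cases q) (auto simp: branch_def branch_inv_def)

context alpha_cf
begin

text \<open>The branch with digit \<open>d\<close> is numbered \<open>2 d\<close> for positive and \<open>2 d + 1\<close> for negative \<open>x\<close>.\<close>

definition piece_digit :: "nat \<Rightarrow> real" where
  "piece_digit n = real (n div 2)"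

definition piece_sign :: "nat \<Rightarrow> real" where
  "piece_sign n = (if even n then 1 else - 1)"

definition piece_index :: "real \<Rightarrow> nat" where
  "piece_index x = 2 * nat (digit \<alpha> x) + (if x < 0 then 1 else 0)"

abbreviation piece_map :: "nat \<Rightarrow> real \<times> real \<Rightarrow> real \<times> real" where
  "piece_map n \<equiv> branch (piece_digit n) (piece_sign n)"

abbreviation piece_inv :: "nat \<Rightarrow> real \<times> real \<Rightarrow> real \<times> real" where
  "piece_inv n \<equiv> branch_inv (piece_digit n) (piece_sign n)"

text \<open>Here the digit jumps. At \<open>x = 0\<close> infinitely many branches accumulate.\<close>

definition singular :: "real set" where
  "singular = {0} \<union> {x. \<bar>1 / x\<bar> + 1 - \<alpha> \<in> \<int>}"

lemma piece_sign_cases: "piece_sign n = 1 \<or> piece_sign n = - 1"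
  by (simp add: piece_sign_def)

lemma piece_index_values:
  assumes "x \<in> Ival \<alpha>" "x \<noteq> 0"
  shows "piece_digit (piece_index x) = of_int (digit \<alpha> x)"
    and "piece_sign (piece_index x) = eps x" and "2 \<le> piece_index x"
  using digit_ge(1)[OF assms] by (auto simp: piece_digit_def piece_index_def piece_sign_def eps_def)

lemma planar_map_eq_piece_map:
  assumes "fst p \<in> Ival \<alpha>" "fst p \<noteq> 0"
  shows "planar_map \<alpha> p = piece_map (piece_index (fst p)) p"
  using assms by (cases p) (simp add: planar_map_pair branch_def piece_index_values cf_map_nonzero)

lemma countable_singular: "countable singular"
proof -
  have "singular \<subseteq> {0} \<union> (\<lambda>(k, e). e / (k - 1 + \<alpha>)) ` (\<int> \<times> {1, - 1})"
  proof
    fix x assume x: "x \<in> singular"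
    show "x \<in> {0} \<union> (\<lambda>(k, e). e / (k - 1 + \<alpha>)) ` (\<int> \<times> {1, - 1})"
    proof (cases "x = 0")
      case False
      then have k: "\<bar>1 / x\<bar> + 1 - \<alpha> \<in> \<int>" using x by (simp add: singular_def)
      have "x = eps x / ((\<bar>1 / x\<bar> + 1 - \<alpha>) - 1 + \<alpha>)" using False by (simp add: eps_def)
      then have "x = (\<lambda>(k, e). e / (k - 1 + \<alpha>)) (\<bar>1 / x\<bar> + 1 - \<alpha>, eps x)" by simp
      moreover have "(\<bar>1 / x\<bar> + 1 - \<alpha>, eps x) \<in> \<int> \<times> {1, - 1}" using k eps_cases by auto
      ultimately show ?thesis by blast
    qed simp
  qed
  moreover have "countable ({0} \<union> (\<lambda>(k, e). e / (k - 1 + \<alpha>)) ` ((\<int> :: real set) \<times> {1, - 1}))"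
    by (simp add: countable_int)
  ultimately show ?thesis by (rule countable_subset)
qed

lemma Omega_bounds: "Omega \<alpha> \<subseteq> Ival \<alpha> \<times> {0..1}"
  by (rule Omega_subset[OF alpha_pos alpha_le_1])

lemma compact_Omega: "compact (Omega \<alpha>)"
proof -
  have "compact (Ival \<alpha> \<times> {0..1::real})" unfolding Ival_def by (intro compact_Times) auto
  moreover have "closed (Omega \<alpha>)" by (simp add: Omega_def)
  ultimately have "compact ((Ival \<alpha> \<times> {0..1}) \<inter> Omega \<alpha>)" by (rule compact_Int_closed)
  then show ?thesis using Omega_bounds by (simp add: Int_absorb1)
qed

lemma orbit_set_subset_Omega: "orbit_set \<subseteq> Omega \<alpha>"
  by (simp add: Omega_eq_closure closure_subset)

lemma planar_map_orbit_set:
  assumes "p \<in> orbit_set"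
  shows "planar_map \<alpha> p \<in> orbit_set"
proof -
  obtain x n where x: "x \<in> {\<alpha> - 1..<\<alpha>}" "p = (planar_map \<alpha> ^^ n) (x, 0)"
    using assms by (auto simp: orbit_set_def)
  then have "planar_map \<alpha> p = (planar_map \<alpha> ^^ Suc n) (x, 0)" by simp
  then show ?thesis unfolding orbit_set_def using x(1) by blast
qed

lemma Omega_denominator:
  assumes "p \<in> Omega \<alpha>" "fst p \<noteq> 0"
  shows "1 \<le> piece_digit (piece_index (fst p)) + piece_sign (piece_index (fst p)) * snd p"
  using denominator_ge_1[of "fst p" "snd p"] assms Omega_bounds
  by (cases p) (auto simp: piece_index_values)

text \<open>Off \<open>singular\<close> the digit and the sign are locally constant, so the map is continuous there and carries
  limits of orbit points to limits of orbit points.\<close>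

lemma planar_map_Omega:
  assumes p: "p \<in> Omega \<alpha>" "fst p \<notin> singular"
  shows "planar_map \<alpha> p \<in> Omega \<alpha>"
proof -
  define x where "x = fst p"
  have x0: "x \<noteq> 0" and xI: "x \<in> Ival \<alpha>" using p Omega_bounds by (auto simp: singular_def x_def)
  obtain f where f: "\<And>k. f k \<in> orbit_set" "f \<longlonglongrightarrow> p"
    using p(1) unfolding Omega_eq_closure closure_sequential by blast
  have fx: "(\<lambda>k. fst (f k)) \<longlonglongrightarrow> x" using tendsto_fst[OF f(2)] by (simp add: x_def)
  have fin: "fst (f k) \<in> Ival \<alpha>" for k using f(1) orbit_set_subset_Omega Omega_bounds by (metis SigmaD1 prod.collapse subsetD)
  have "(\<lambda>k. \<bar>1 / fst (f k)\<bar> + 1 - \<alpha>) \<longlonglongrightarrow> \<bar>1 / x\<bar> + 1 - \<alpha>"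
    using x0 by (intro tendsto_intros fx) auto
  then have dg: "\<forall>\<^sub>F k in sequentially. digit \<alpha> (fst (f k)) = digit \<alpha> x"
    unfolding digit_def by (rule eventually_floor_eq) (use p(2) in \<open>simp add: singular_def x_def\<close>)
  have sg: "\<forall>\<^sub>F k in sequentially. (fst (f k) < 0 \<longleftrightarrow> x < 0) \<and> fst (f k) \<noteq> 0"
  proof (cases "x < 0")
    case True
    show ?thesis by (rule eventually_mono[OF order_tendstoD(2)[OF fx True]]) (use True in auto)
  next
    case False
    then have "0 < x" using x0 by simp
    show ?thesis by (rule eventually_mono[OF order_tendstoD(1)[OF fx \<open>0 < x\<close>]]) (use False in auto)
  qed
  define n where "n = piece_index x"
  have "(\<lambda>k. piece_map n (f k)) \<longlonglongrightarrow> piece_map n p"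
    unfolding branch_def
    using x0 Omega_denominator[OF p(1)] by (intro tendsto_intros f(2)) (auto simp: x_def n_def)
  moreover have "\<forall>\<^sub>F k in sequentially. piece_map n (f k) = planar_map \<alpha> (f k)"
    using dg sg
  proof eventually_elim
    case (elim k)
    then have "piece_index (fst (f k)) = n" by (simp add: piece_index_def n_def)
    then show ?case using planar_map_eq_piece_map[OF fin] elim by simp
  qed
  ultimately have "(\<lambda>k. planar_map \<alpha> (f k)) \<longlonglongrightarrow> piece_map n p"
    by (rule Lim_transform_eventually)
  moreover have "piece_map n p = planar_map \<alpha> p"
    using planar_map_eq_piece_map[of p] x0 xI by (simp add: x_def n_def)
  moreover have "planar_map \<alpha> (f k) \<in> Omega \<alpha>" for k
    using planar_map_orbit_set[OF f(1)] orbit_set_subset_Omega by blast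
  ultimately show ?thesis
    using closed_sequentially[OF compact_imp_closed[OF compact_Omega], of "\<lambda>k. planar_map \<alpha> (f k)"] by simp
qed

text \<open>The closed cylinder of digit and sign \<open>n\<close>. The bound on the denominator excludes points where the branch
  formula is discontinuous; points of \<open>Omega \<alpha>\<close> with this digit and sign satisfy it.\<close>

definition closed_piece :: "nat \<Rightarrow> (real \<times> real) set" where
  "closed_piece n = {p \<in> Omega \<alpha>. piece_sign n * fst p \<in> {1 / (piece_digit n + \<alpha>)..1 / (piece_digit n + \<alpha> - 1)}
     \<and> 1 \<le> piece_digit n + piece_sign n * snd p}"

lemma in_closed_piece:
  assumes p: "p \<in> Omega \<alpha>" "fst p \<noteq> 0"
  shows "p \<in> closed_piece (piece_index (fst p))"
proof -
  define x where "x = fst p"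
  have x: "x \<in> Ival \<alpha>" "x \<noteq> 0" using p Omega_bounds by (auto simp: x_def)
  define d where "d = real_of_int (digit \<alpha> x)"
  have d1: "1 \<le> d" using digit_ge(1)[OF x] by (simp add: d_def)
  have "d \<le> \<bar>1 / x\<bar> + 1 - \<alpha>" "\<bar>1 / x\<bar> + 1 - \<alpha> < d + 1" unfolding d_def digit_def by linarith+
  then have b: "d + \<alpha> - 1 \<le> 1 / \<bar>x\<bar>" "1 / \<bar>x\<bar> \<le> d + \<alpha>" by simp_all
  have pos: "0 < d + \<alpha> - 1" "0 < \<bar>x\<bar>" using d1 alpha_pos x by auto
  have "\<bar>x\<bar> \<le> 1 / (d + \<alpha> - 1)" "1 / (d + \<alpha>) \<le> \<bar>x\<bar>" using b pos alpha_pos d1 by (auto simp: field_simps)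
  moreover have "eps x * x = \<bar>x\<bar>" by (simp add: eps_def)
  ultimately show ?thesis
    using p Omega_denominator[OF p] x by (simp add: closed_piece_def piece_index_values x_def d_def)
qed

lemma compact_piece_image:
  assumes "2 \<le> n"
  shows "compact (piece_map n ` closed_piece n)"
proof (rule compact_continuous_image)
  have n1: "1 \<le> piece_digit n"
  proof -
    have "1 \<le> n div 2" using assms by simp
    then show ?thesis unfolding piece_digit_def by linarith
  qed
  have "fst p \<noteq> 0" "piece_digit n + piece_sign n * snd p \<noteq> 0" if "p \<in> closed_piece n" for p
  proof -
    have "0 < 1 / (piece_digit n + \<alpha>)" using n1 alpha_pos by simp
    then show "fst p \<noteq> 0" using that by (auto simp: closed_piece_def)
    show "piece_digit n + piece_sign n * snd p \<noteq> 0" using that by (auto simp: closed_piece_def)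
  qed
  then show "continuous_on (closed_piece n) (piece_map n)"
    unfolding branch_def by (intro continuous_intros) auto
  have "closed_piece n = Omega \<alpha> \<inter> ({p. 1 / (piece_digit n + \<alpha>) \<le> piece_sign n * fst p}
      \<inter> {p. piece_sign n * fst p \<le> 1 / (piece_digit n + \<alpha> - 1)}
      \<inter> {p. 1 \<le> piece_digit n + piece_sign n * snd p})"
    by (auto simp: closed_piece_def)
  also have "compact \<dots>"
    by (intro compact_Int_closed compact_Omega closed_Int closed_Collect_le continuous_intros)
  finally show "compact (closed_piece n)" .
qed

text \<open>Near \<open>q\<close> the heights are bounded below, so the orbit points there come from one step with one of finitely
  many digits. They lie in a finite union of compact images, which then contains \<open>q\<close> as well. The preimage
  found for \<open>q\<close> may be an end point of the cylinder; this is why closed pieces occur.\<close>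

lemma Omega_backward:
  assumes q: "q \<in> Omega \<alpha>" "0 < snd q"
  shows "\<exists>n\<ge>2. q \<in> piece_map n ` closed_piece n"
proof -
  define c where "c = snd q / 2"
  have c: "0 < c" "c < snd q" using q by (auto simp: c_def)
  obtain N :: nat where N: "2 / c + 3 \<le> real N" using real_arch_simple by blast
  define H where "H = (\<Union>n\<in>{2..N}. piece_map n ` closed_piece n)"
  have "closed H" unfolding H_def by (intro closed_UN ballI compact_imp_closed[OF compact_piece_image]) auto
  have "{p. c < snd p} \<inter> orbit_set \<subseteq> H"
  proof
    fix p assume p: "p \<in> {p. c < snd p} \<inter> orbit_set"
    then obtain x m where x: "x \<in> {\<alpha> - 1..<\<alpha>}" "p = (planar_map \<alpha> ^^ m) (x, 0)"
      by (auto simp: orbit_set_def)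
    then obtain m' where m: "m = Suc m'" using p c by (cases m) auto
    define r where "r = (planar_map \<alpha> ^^ m') (x, 0)"
    have r: "r \<in> Omega \<alpha>" using x orbit_set_subset_Omega by (auto simp: r_def orbit_set_def)
    have pr: "p = planar_map \<alpha> r" using x m by (simp add: r_def)
    have r0: "fst r \<noteq> 0"
    proof
      assume "fst r = 0"
      then have "snd p = 0" unfolding pr by (cases r) (simp add: planar_map_pair)
      then show False using p c by simp
    qed
    define n where "n = piece_index (fst r)"
    have rI: "fst r \<in> Ival \<alpha>" "snd r \<le> 1" "0 \<le> snd r" using r Omega_bounds by auto
    have pn: "p = piece_map n r" using planar_map_eq_piece_map[OF rI(1) r0] by (simp add: pr n_def)
    have den: "1 \<le> piece_digit n + piece_sign n * snd r" using Omega_denominator[OF r r0] by (simp add: n_def)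
    have "c < 1 / (piece_digit n + piece_sign n * snd r)" using p by (simp add: pn branch_def)
    then have "piece_digit n + piece_sign n * snd r < 1 / c" using den c by (simp add: field_simps)
    then have "piece_digit n < 1 / c + 1" using piece_sign_cases[of n] rI by auto
    moreover have "real n \<le> 2 * piece_digit n + 1" unfolding piece_digit_def by linarith
    ultimately have "real n \<le> real N" using N by simp
    then have "n \<in> {2..N}" using piece_index_values(3)[OF rI(1) r0] by (simp add: n_def)
    then show "p \<in> H" unfolding H_def pn using in_closed_piece[OF r r0] by (auto simp: n_def)
  qed
  then have "closure ({p. c < snd p} \<inter> orbit_set) \<subseteq> H" using \<open>closed H\<close> by (rule closure_minimal)
  moreover have "open {p :: real \<times> real. c < snd p}" by (intro open_Collect_less continuous_intros)
  ultimately have "q \<in> H"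
    using open_Int_closure_subset[of "{p. c < snd p}" orbit_set] q c unfolding Omega_eq_closure by blast
  then show ?thesis by (auto simp: H_def)
qed

text \<open>In contrast to \<open>closed_piece n\<close>, the sets \<open>piece n\<close> are disjoint and \<open>planar_map \<alpha>\<close> is the branch \<open>n\<close> on
  them. The image is written as a preimage under the inverse branch, so that it is visibly Borel.\<close>

definition piece :: "nat \<Rightarrow> (real \<times> real) set" where
  "piece n = {p \<in> Omega \<alpha>. fst p \<notin> singular \<and> piece_index (fst p) = n}"

definition piece_image :: "nat \<Rightarrow> (real \<times> real) set" where
  "piece_image n = {q. piece_inv n q \<in> piece n}"

text \<open>The points to which \<open>Omega_backward\<close> does not apply, or for which it may give a preimage over a
  discontinuity.\<close>

definition exceptional :: "(real \<times> real) set" where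
  "exceptional = {q. snd q = 0 \<or> fst q \<in> (\<Union>n. (\<lambda>x. piece_sign n / x - piece_digit n) ` singular)}"

lemma in_piece:
  assumes "p \<in> piece n"
  shows "p \<in> Omega \<alpha>" "fst p \<noteq> 0" "planar_map \<alpha> p = piece_map n p"
    "piece_inv n (piece_map n p) = p" "piece_map n p \<in> Omega \<alpha>" "piece_map n p \<in> piece_image n"
proof -
  show p: "p \<in> Omega \<alpha>" "fst p \<noteq> 0" using assms by (auto simp: piece_def singular_def)
  have n: "piece_index (fst p) = n" "fst p \<notin> singular" using assms by (auto simp: piece_def)
  show eq: "planar_map \<alpha> p = piece_map n p"
    using planar_map_eq_piece_map[of p] p Omega_bounds n by auto
  show inv: "piece_inv n (piece_map n p) = p"
    using Omega_denominator[OF p] n by (intro branch_inv_branch piece_sign_cases p) auto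
  show "piece_map n p \<in> Omega \<alpha>" using planar_map_Omega[OF p(1) n(2)] by (simp add: eq)
  show "piece_map n p \<in> piece_image n" using assms by (simp add: piece_image_def inv)
qed

lemma in_piece_image:
  assumes "q \<in> piece_image n"
  shows "piece_inv n q \<in> piece n" "piece_map n (piece_inv n q) = q" "q \<in> Omega \<alpha>"
proof -
  show p: "piece_inv n q \<in> piece n" using assms by (simp add: piece_image_def)
  then have n: "piece_index (fst (piece_inv n q)) = n" by (simp add: piece_def)
  show eq: "piece_map n (piece_inv n q) = q"
    using in_piece(1,2)[OF p] Omega_denominator[OF in_piece(1,2)[OF p]] unfolding n
    by (intro branch_branch_inv piece_sign_cases) auto
  show "q \<in> Omega \<alpha>" using in_piece(5)[OF p] by (simp add: eq)
qed

lemma Omega_covered: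
  assumes "q \<in> Omega \<alpha>" "q \<notin> exceptional"
  shows "\<exists>n. q \<in> piece_image n"
proof -
  have "0 \<le> snd q" using assms(1) Omega_bounds by auto
  then have "0 < snd q" using assms(2) by (auto simp: exceptional_def)
  from Omega_backward[OF assms(1) this] obtain n p
    where n: "2 \<le> n" "p \<in> closed_piece n" "q = piece_map n p" by auto
  have ns: "fst p \<notin> singular"
  proof
    assume "fst p \<in> singular"
    then have "fst q \<in> (\<lambda>x. piece_sign n / x - piece_digit n) ` singular" by (auto simp: n branch_def)
    then show False using assms(2) by (auto simp: exceptional_def)
  qed
  define x where "x = fst p"
  have x: "x \<noteq> 0" using ns by (auto simp: singular_def x_def)
  have d1: "1 \<le> piece_digit n"
  proof -
    have "1 \<le> n div 2" using n by simp
    then show ?thesis unfolding piece_digit_def by linarith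
  qed
  have b: "1 / (piece_digit n + \<alpha>) \<le> piece_sign n * x" "piece_sign n * x \<le> 1 / (piece_digit n + \<alpha> - 1)"
    using n(2) by (auto simp: closed_piece_def x_def)
  have "0 < 1 / (piece_digit n + \<alpha>)" using d1 alpha_pos by simp
  then have pos: "0 < piece_sign n * x" using b by linarith
  then have ax: "piece_sign n * x = \<bar>x\<bar>" using piece_sign_cases[of n] by auto
  have "1 / \<bar>x\<bar> \<le> piece_digit n + \<alpha>" "piece_digit n + \<alpha> - 1 \<le> 1 / \<bar>x\<bar>"
    using b d1 alpha_pos x unfolding ax by (auto simp: field_simps)
  then have "of_int (int (n div 2)) \<le> \<bar>1 / x\<bar> + 1 - \<alpha>" "\<bar>1 / x\<bar> + 1 - \<alpha> \<le> of_int (int (n div 2)) + 1"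
    by (simp_all add: piece_digit_def)
  moreover have "\<bar>1 / x\<bar> + 1 - \<alpha> \<noteq> of_int (int (n div 2)) + 1"
  proof
    assume "\<bar>1 / x\<bar> + 1 - \<alpha> = of_int (int (n div 2)) + 1"
    then have "\<bar>1 / x\<bar> + 1 - \<alpha> \<in> \<int>" by (metis Ints_1 Ints_add Ints_of_int)
    then show False using ns by (simp add: singular_def x_def)
  qed
  ultimately have "digit \<alpha> x = int (n div 2)" unfolding digit_def by (intro floor_unique) auto
  moreover have "x < 0 \<longleftrightarrow> odd n" using pos x by (auto simp: piece_sign_def zero_less_mult_iff split: if_splits)
  ultimately have "piece_index x = n" by (auto simp: piece_index_def)
  then have "p \<in> piece n" using n(2) ns by (auto simp: piece_def closed_piece_def x_def)
  from in_piece(6)[OF this] show ?thesis unfolding n(3) ..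
qed

end

section \<open>Almost everywhere invertibility\<close>

definition cf_measure :: "(real \<times> real) measure" where
  "cf_measure = density lborel cf_weight"

lemma sets_cf_measure [measurable_cong, simp]: "sets cf_measure = sets borel"
  by (simp add: cf_measure_def)

lemma space_cf_measure [simp]: "space cf_measure = UNIV"
  by (simp add: cf_measure_def)

lemma AE_cf_measure: "AE p in lborel. P p \<Longrightarrow> AE p in cf_measure. P p"
  unfolding cf_measure_def by (subst AE_density) auto

lemma AE_not_in_vertical_lines:
  fixes C :: "real set"
  assumes "countable C"
  shows "AE p in cf_measure. fst p \<notin> C"
proof (rule AE_cf_measure)
  have [measurable]: "C \<in> sets borel" using assms by (rule sets.countable[rotated]) simp
  have "emeasure (lborel \<Otimes>\<^sub>M lborel) (C \<times> (UNIV :: real set)) = 0"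
    by (subst lborel.emeasure_pair_measure_Times) (auto simp: emeasure_lborel_countable[OF assms])
  then have "C \<times> (UNIV :: real set) \<in> null_sets lborel"
    using borel_Times[of C "UNIV :: real set"] by (intro null_setsI) (simp_all add: lborel_prod)
  then show "AE p :: real \<times> real in lborel. fst p \<notin> C" by (rule AE_I') auto
qed

lemma AE_not_on_axis: "AE p in cf_measure. snd p \<noteq> (0 :: real)"
proof (rule AE_cf_measure)
  have "emeasure (lborel \<Otimes>\<^sub>M lborel) ((UNIV :: real set) \<times> {0 :: real}) = 0"
    by (subst lborel.emeasure_pair_measure_Times) auto
  then have "(UNIV :: real set) \<times> {0 :: real} \<in> null_sets lborel"
    using borel_Times[of "UNIV :: real set" "{0 :: real}"] by (intro null_setsI) (simp_all add: lborel_prod)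
  then show "AE p :: real \<times> real in lborel. snd p \<noteq> 0" by (rule AE_I') auto
qed

lemma nn_integral_eq_imp_AE_eq:
  assumes [measurable]: "f \<in> borel_measurable M" "g \<in> borel_measurable M"
    and le: "AE x in M. f x \<le> g x" and eq: "integral\<^sup>N M f = integral\<^sup>N M g" and fin: "integral\<^sup>N M f \<noteq> \<infinity>"
  shows "AE x in M. f x = g x"
proof -
  have "(\<integral>\<^sup>+x. g x - f x \<partial>M) = integral\<^sup>N M g - integral\<^sup>N M f"
    by (intro nn_integral_diff fin le) auto
  also have "\<dots> = 0" using fin by (simp add: eq)
  finally have "AE x in M. g x - f x = 0" by (subst (asm) nn_integral_0_iff_AE) auto
  then show ?thesis using le by eventually_elim (simp add: antisym ennreal_minus_eq_0)
qed

context alpha_cf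
begin

lemma measurable_cf [measurable]:
  "digit \<alpha> \<in> measurable borel (count_space UNIV)"
  "cf_map \<alpha> \<in> borel_measurable borel"
  "eps \<in> borel_measurable borel"
  "planar_map \<alpha> \<in> borel_measurable borel"
  "piece_index \<in> measurable borel (count_space UNIV)"
proof -
  show 1 [measurable]: "digit \<alpha> \<in> measurable borel (count_space UNIV)"
    unfolding digit_def by measurable
  show [measurable]: "eps \<in> borel_measurable borel" unfolding eps_def by measurable
  show [measurable]: "cf_map \<alpha> \<in> borel_measurable borel" unfolding cf_map_def by measurable
  have "(\<lambda>p. planar_map \<alpha> p) = (\<lambda>p. (cf_map \<alpha> (fst p),
      if fst p = 0 then 0 else 1 / (of_int (digit \<alpha> (fst p)) + eps (fst p) * snd p)))"
    by (auto simp: planar_map_def fun_eq_iff)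
  also have "\<dots> \<in> borel_measurable borel"
    unfolding borel_prod[symmetric] by measurable
  finally show "planar_map \<alpha> \<in> borel_measurable borel" .
  show "piece_index \<in> measurable borel (count_space UNIV)"
    unfolding piece_index_def by measurable
qed

lemma measurable_sets_cf [measurable]:
  "singular \<in> sets borel" "Omega \<alpha> \<in> sets borel" "piece n \<in> sets borel" "piece_image n \<in> sets borel"
proof -
  show [measurable]: "singular \<in> sets borel"
    using countable_singular by (rule sets.countable[rotated]) simp
  show [measurable]: "Omega \<alpha> \<in> sets borel"
    using compact_Omega by (simp add: borel_compact)
  have [measurable]: "(fst :: real \<times> real \<Rightarrow> real) \<in> borel_measurable borel"
    by (simp add: borel_prod[symmetric])
  show [measurable]: "piece n \<in> sets borel" unfolding piece_def by measurable
  show "piece_image n \<in> sets borel" unfolding piece_image_def by measurable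
qed

lemma emeasure_piece_image:
  assumes [measurable]: "E \<in> sets borel"
  shows "emeasure cf_measure (piece n \<inter> piece_map n -` E) = emeasure cf_measure (piece_image n \<inter> E)"
proof -
  have [measurable]: "piece_map n -` E \<in> sets borel"
    using measurable_sets[OF branch_measurable(1), of E] by simp
  have "emeasure cf_measure (piece n \<inter> piece_map n -` E)
      = (\<integral>\<^sup>+p. indicator (piece n \<inter> piece_map n -` E) p * cf_weight p \<partial>lborel)"
    unfolding cf_measure_def by (subst emeasure_density) (simp_all add: mult.commute)
  also have "\<dots> = (\<integral>\<^sup>+p. indicator (piece n \<inter> piece_map n -` E) (piece_inv n p) * cf_weight p \<partial>lborel)"
    by (intro nn_integral_branch_inv piece_sign_cases) simp
  also have "\<dots> = (\<integral>\<^sup>+p. indicator (piece_image n \<inter> E) p * cf_weight p \<partial>lborel)"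
    using in_piece_image(2) by (intro nn_integral_cong) (auto simp: piece_image_def split: split_indicator)
  also have "\<dots> = emeasure cf_measure (piece_image n \<inter> E)"
    unfolding cf_measure_def by (subst emeasure_density) (simp_all add: mult.commute)
  finally show ?thesis .
qed

text \<open>The density is bounded on \<open>Omega \<alpha>\<close> because \<open>x y \<ge> \<alpha> - 1\<close> there.\<close>

lemma emeasure_Omega_finite: "emeasure cf_measure (Omega \<alpha>) \<noteq> \<infinity>"
proof -
  have "emeasure cf_measure (Omega \<alpha>) = (\<integral>\<^sup>+p. cf_weight p * indicator (Omega \<alpha>) p \<partial>lborel)"
    unfolding cf_measure_def by (rule emeasure_density) simp_all
  also have "\<dots> \<le> (\<integral>\<^sup>+p. ennreal (1 / \<alpha>\<^sup>2) * indicator (Omega \<alpha>) p \<partial>lborel)"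
  proof (rule nn_integral_mono)
    fix p :: "real \<times> real"
    show "cf_weight p * indicator (Omega \<alpha>) p \<le> ennreal (1 / \<alpha>\<^sup>2) * indicator (Omega \<alpha>) p"
    proof (cases "p \<in> Omega \<alpha>")
      case True
      then have "\<alpha> \<le> 1 + fst p * snd p"
        using Omega_bounds by (intro one_plus_xy_ge) (auto simp: Ival_def)
      then have "1 / (1 + fst p * snd p)\<^sup>2 \<le> 1 / \<alpha>\<^sup>2"
        using alpha_pos by (intro frac_le power_mono) auto
      then show ?thesis by (simp add: True cf_weight_def)
    qed simp
  qed
  also have "\<dots> = ennreal (1 / \<alpha>\<^sup>2) * emeasure lborel (Omega \<alpha>)"
    by (subst nn_integral_cmult_indicator) simp_all
  also have "\<dots> < \<infinity>"
    using emeasure_compact_finite[OF compact_Omega] by (simp add: ennreal_mult_less_top)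
  finally show ?thesis by simp
qed

lemma cf_weight_pos:
  assumes "p \<in> Omega \<alpha>"
  shows "0 < cf_weight p"
proof -
  have "\<alpha> \<le> 1 + fst p * snd p"
    using assms Omega_bounds by (intro one_plus_xy_ge) (auto simp: Ival_def)
  then show ?thesis using alpha_pos by (simp add: cf_weight_def)
qed

lemma emeasure_Omega_pos: "0 < emeasure cf_measure (Omega \<alpha>)"
proof (rule ccontr)
  define U where "U = {\<alpha> - 1<..<\<alpha>} \<times> {0<..<\<alpha> ^ 3 / 32}"
  have U: "open U" "U \<subseteq> Omega \<alpha>" "U \<noteq> {}"
    using Omega_contains_rectangle alpha_pos by (auto simp: U_def intro!: open_Times)
  assume "\<not> ?thesis"
  then have "Omega \<alpha> \<in> null_sets cf_measure" by (simp add: null_sets_def)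
  then have "AE p in cf_measure. p \<notin> Omega \<alpha>" by (rule AE_not_in)
  then have "AE p in lborel. 0 < cf_weight p \<longrightarrow> p \<notin> Omega \<alpha>"
    unfolding cf_measure_def by (subst (asm) AE_density) simp_all
  then have "AE p in lborel. p \<notin> U" by eventually_elim (use U cf_weight_pos in blast)
  then have "U \<in> null_sets lborel" using U(1) by (intro iffD2[OF AE_iff_null_sets]) simp_all
  moreover have "emeasure lborel U \<noteq> 0"
    unfolding U_def lborel_prod[symmetric]
    using alpha_pos by (subst lborel.emeasure_pair_measure_Times) (auto simp: ennreal_eq_0_iff)
  ultimately show False by (simp add: null_sets_def)
qed

lemma AE_not_exceptional: "AE q in cf_measure. q \<notin> exceptional"
proof -
  have "countable (\<Union>n. (\<lambda>x. piece_sign n / x - piece_digit n) ` singular)"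
    using countable_singular by (intro countable_UN countable_image) auto
  from AE_not_in_vertical_lines[OF this] AE_not_on_axis show ?thesis
    by eventually_elim (simp add: exceptional_def)
qed

lemma emeasure_planar_map_vimage:
  assumes [measurable]: "E \<in> sets borel"
  shows "emeasure cf_measure (Omega \<alpha> \<inter> planar_map \<alpha> -` E)
    = (\<integral>\<^sup>+q. (\<Sum>n. indicator (piece_image n) q) * indicator E q \<partial>cf_measure)"
proof -
  have [measurable]: "piece_map n -` E \<in> sets borel" for n
    using measurable_sets[OF branch_measurable(1), of E] by simp
  have [measurable]: "planar_map \<alpha> -` E \<in> sets borel"
    using measurable_sets[OF measurable_cf(4), of E] by simp
  have "emeasure cf_measure (Omega \<alpha> \<inter> planar_map \<alpha> -` E)
      = emeasure cf_measure (\<Union>n. piece n \<inter> piece_map n -` E)"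
  proof (rule emeasure_eq_AE)
    show "AE p in cf_measure. p \<in> Omega \<alpha> \<inter> planar_map \<alpha> -` E \<longleftrightarrow> p \<in> (\<Union>n. piece n \<inter> piece_map n -` E)"
      using AE_not_in_vertical_lines[OF countable_singular]
    proof eventually_elim
      case (elim p)
      have "p \<in> Omega \<alpha> \<longleftrightarrow> (\<exists>n. p \<in> piece n)" using elim by (auto simp: piece_def)
      moreover have "planar_map \<alpha> p \<in> E \<longleftrightarrow> piece_map n p \<in> E" if "p \<in> piece n" for n
        using in_piece(3)[OF that] by simp
      ultimately show ?case by blast
    qed
  qed auto
  also have "\<dots> = (\<Sum>n. emeasure cf_measure (piece n \<inter> piece_map n -` E))"
  proof (rule suminf_emeasure[symmetric])
    show "disjoint_family (\<lambda>n. piece n \<inter> piece_map n -` E)"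
      by (auto simp: disjoint_family_on_def piece_def)
  qed auto
  also have "\<dots> = (\<Sum>n. \<integral>\<^sup>+q. indicator (piece_image n) q * indicator E q \<partial>cf_measure)"
    by (simp add: emeasure_piece_image flip: indicator_inter_arith)
  also have "\<dots> = (\<integral>\<^sup>+q. (\<Sum>n. indicator (piece_image n) q * indicator E q) \<partial>cf_measure)"
    by (intro nn_integral_suminf[symmetric]) simp
  also have "\<dots> = (\<integral>\<^sup>+q. (\<Sum>n. indicator (piece_image n) q) * indicator E q \<partial>cf_measure)"
    by simp
  finally show ?thesis .
qed

text \<open>The number of pieces whose image contains \<open>q\<close> is at least \<open>1\<close> for almost every \<open>q\<close> in \<open>Omega \<alpha>\<close>,
  and its integral is the total measure of the pieces, that is, the measure of \<open>Omega \<alpha>\<close>. As this is finite, the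
  number is almost everywhere equal to \<open>1\<close>.\<close>

lemma AE_piece_images_tile_Omega:
  "AE q in cf_measure. (\<Sum>n. indicator (piece_image n) q) = (indicator (Omega \<alpha>) q :: ennreal)"
proof -
  have "AE q in cf_measure. indicator (Omega \<alpha>) q = (\<Sum>n. indicator (piece_image n) q :: ennreal)"
  proof (rule nn_integral_eq_imp_AE_eq)
    show "AE q in cf_measure. indicator (Omega \<alpha>) q \<le> (\<Sum>n. indicator (piece_image n) q :: ennreal)"
      using AE_not_exceptional
    proof eventually_elim
      case (elim q)
      show ?case
      proof (cases "q \<in> Omega \<alpha>")
        case True
        then obtain n where "q \<in> piece_image n" using Omega_covered elim by blast
        then have "1 \<le> (\<Sum>i\<in>{n}. indicator (piece_image i) q :: ennreal)" by simp
        also have "\<dots> \<le> (\<Sum>n. indicator (piece_image n) q)" by (rule sum_le_suminf) auto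
        finally show ?thesis by (simp add: True)
      qed simp
    qed
    show "integral\<^sup>N cf_measure (indicator (Omega \<alpha>)) = (\<integral>\<^sup>+q. (\<Sum>n. indicator (piece_image n) q) \<partial>cf_measure)"
      using emeasure_planar_map_vimage[of UNIV] by simp
    show "integral\<^sup>N cf_measure (indicator (Omega \<alpha>)) \<noteq> \<infinity>"
      using emeasure_Omega_finite by simp
  qed simp_all
  then show ?thesis by eventually_elim simp
qed

lemma planar_map_preserves_cf_measure:
  assumes [measurable]: "E \<in> sets borel"
  shows "emeasure cf_measure (Omega \<alpha> \<inter> planar_map \<alpha> -` E) = emeasure cf_measure (Omega \<alpha> \<inter> E)"
proof -
  have "emeasure cf_measure (Omega \<alpha> \<inter> planar_map \<alpha> -` E)
      = (\<integral>\<^sup>+q. indicator (Omega \<alpha>) q * indicator E q \<partial>cf_measure)"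
    unfolding emeasure_planar_map_vimage[OF assms]
    by (rule nn_integral_cong_AE) (use AE_piece_images_tile_Omega in eventually_elim, simp)
  then show ?thesis by (simp flip: indicator_inter_arith)
qed

text \<open>Almost everywhere on \<open>Omega \<alpha>\<close> exactly one index is admissible. Choosing the least one gives a Borel map
  that is defined everywhere.\<close>

definition inverse_map :: "real \<times> real \<Rightarrow> real \<times> real" where
  "inverse_map q = piece_inv (LEAST n. q \<in> piece_image n) q"

lemma inverse_map_measurable [measurable]: "inverse_map \<in> borel_measurable borel"
  unfolding inverse_map_def
  by (rule measurable_compose_countable[of "\<lambda>n q. piece_inv n q"]) measurable

lemma AE_planar_map_inverse_map: "AE q in cf_measure. q \<in> Omega \<alpha> \<longrightarrow> planar_map \<alpha> (inverse_map q) = q"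
  using AE_not_exceptional
proof eventually_elim
  case (elim q)
  show ?case
  proof
    assume "q \<in> Omega \<alpha>"
    then have "\<exists>n. q \<in> piece_image n" using Omega_covered elim by blast
    then have "q \<in> piece_image (LEAST n. q \<in> piece_image n)" by (rule LeastI_ex)
    from in_piece_image[OF this] in_piece(3)[OF in_piece_image(1)[OF this]]
    show "planar_map \<alpha> (inverse_map q) = q" by (simp add: inverse_map_def)
  qed
qed

lemma inverse_map_planar_map:
  assumes p: "p \<in> Omega \<alpha>" "fst p \<notin> singular"
    and one: "(\<Sum>n. indicator (piece_image n) (planar_map \<alpha> p)) = (1 :: ennreal)"
  shows "inverse_map (planar_map \<alpha> p) = p"
proof -
  define n where "n = piece_index (fst p)"
  have pn: "p \<in> piece n" using p by (simp add: piece_def n_def)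
  define q where "q = planar_map \<alpha> p"
  have q1: "q = piece_map n p" unfolding q_def by (rule in_piece(3)[OF pn])
  have q: "q \<in> piece_image n" "piece_inv n q = p" unfolding q1 by (rule in_piece[OF pn])+
  have uniq: "k = n" if "q \<in> piece_image k" for k
  proof (rule ccontr)
    assume "k \<noteq> n"
    then have "2 = (\<Sum>i\<in>{k, n}. indicator (piece_image i) q :: ennreal)" using that q(1) by simp
    also have "\<dots> \<le> (\<Sum>k. indicator (piece_image k) q)" by (rule sum_le_suminf) auto
    also have "\<dots> = 1" using one by (simp add: q_def)
    finally show False by simp
  qed
  have least: "(LEAST k. q \<in> piece_image k) = n"
    by (rule Least_equality[where P = "\<lambda>k. q \<in> piece_image k", OF q(1)]) (use uniq in \<open>blast intro: eq_refl\<close>)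
  show ?thesis unfolding inverse_map_def q_def[symmetric] least by (rule q(2))
qed

text \<open>The points of \<open>Omega \<alpha>\<close> that lie in several images form a null set; since \<open>planar_map \<alpha>\<close> preserves the
  measure, almost no point is mapped into it.\<close>

lemma AE_inverse_map_planar_map: "AE p in cf_measure. p \<in> Omega \<alpha> \<longrightarrow> inverse_map (planar_map \<alpha> p) = p"
proof -
  \<comment> \<open>The null set on which the images of the pieces fail to tile.\<close>
  define E where "E = {q. (\<Sum>n. indicator (piece_image n) q) \<noteq> (indicator (Omega \<alpha>) q :: ennreal)}"
  have "{q \<in> space borel. (\<Sum>n. indicator (piece_image n) q) \<noteq> (indicator (Omega \<alpha>) q :: ennreal)} \<in> sets borel"
    by measurable
  then have [measurable]: "E \<in> sets borel" by (simp add: E_def)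
  have "E \<in> null_sets cf_measure"
  proof (rule iffD2[OF AE_iff_null_sets])
    show "AE q in cf_measure. q \<notin> E"
      using AE_piece_images_tile_Omega by eventually_elim (simp add: E_def)
  qed simp
  then have "Omega \<alpha> \<inter> E \<in> null_sets cf_measure" by (intro null_set_Int1) simp_all
  then have "emeasure cf_measure (Omega \<alpha> \<inter> planar_map \<alpha> -` E) = 0"
    unfolding planar_map_preserves_cf_measure[OF \<open>E \<in> sets borel\<close>] by (rule null_setsD1)
  moreover have "Omega \<alpha> \<inter> planar_map \<alpha> -` E \<in> sets borel"
    using measurable_sets[OF measurable_cf(4), of E] by simp
  ultimately have AE_E: "AE p in cf_measure. p \<notin> Omega \<alpha> \<inter> planar_map \<alpha> -` E"
    by (intro AE_not_in) (simp add: null_sets_def)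
  have "p \<in> Omega \<alpha> \<longrightarrow> inverse_map (planar_map \<alpha> p) = p"
    if "p \<notin> Omega \<alpha> \<inter> planar_map \<alpha> -` E \<and> fst p \<notin> singular" for p
  proof
    assume p: "p \<in> Omega \<alpha>"
    have "planar_map \<alpha> p \<notin> E" using that p by blast
    moreover have "planar_map \<alpha> p \<in> Omega \<alpha>" using planar_map_Omega p that by blast
    ultimately have "(\<Sum>n. indicator (piece_image n) (planar_map \<alpha> p)) = (1 :: ennreal)"
      by (simp add: E_def)
    then show "inverse_map (planar_map \<alpha> p) = p" using inverse_map_planar_map p that by blast
  qed
  then show ?thesis
    by (rule eventually_mono[OF eventually_conj[OF AE_E AE_not_in_vertical_lines[OF countable_singular]]])
qed

lemma inverse_map_preserves_cf_measure:
  assumes [measurable]: "E \<in> sets borel"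
  shows "emeasure cf_measure (Omega \<alpha> \<inter> inverse_map -` E) = emeasure cf_measure (Omega \<alpha> \<inter> E)"
proof -
  have [measurable]: "inverse_map -` E \<in> sets borel"
    using measurable_sets[OF inverse_map_measurable, of E] by simp
  have [measurable]: "planar_map \<alpha> -` inverse_map -` E \<in> sets borel"
    using measurable_sets[OF measurable_cf(4), of "inverse_map -` E"] by simp
  have "emeasure cf_measure (Omega \<alpha> \<inter> inverse_map -` E)
      = emeasure cf_measure (Omega \<alpha> \<inter> planar_map \<alpha> -` inverse_map -` E)"
    by (simp add: planar_map_preserves_cf_measure)
  also have "\<dots> = emeasure cf_measure (Omega \<alpha> \<inter> E)"
    by (rule emeasure_eq_AE) (use AE_inverse_map_planar_map in \<open>eventually_elim, auto\<close>)
  finally show ?thesis .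
qed

end

section \<open>Measure preserving systems and limits of laws\<close>

text \<open>A measure preserving map may send a null set out of the space. Redefining it there by the identity makes it
  measurable in the strict sense, so that its iterates are measurable too; iterates of the original map need not be.\<close>

lemma measure_preserving_total_version:
  assumes "measure_preserving_system M T"
  obtains T' where "T' \<in> measurable M M" "distr M M T' = M" "AE x in M. T' x = T x"
proof -
  have inv: "T -` A \<inter> space M \<in> sets M" "emeasure M (T -` A \<inter> space M) = emeasure M A" if "A \<in> sets M" for A
    using assms that by (auto simp: measure_preserving_system_def)
  interpret prob_space M using assms by (simp add: measure_preserving_system_def)
  define T' where "T' x = (if T x \<in> space M then T x else x)" for x
  have good: "T -` space M \<inter> space M \<in> sets M" "emeasure M (T -` space M \<inter> space M) = 1"
    using inv[of "space M"] emeasure_space_1 by auto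
  have AE_good: "AE x in M. T x \<in> space M"
    using AE_in_set_eq_1[OF good(1)] good(2) by (simp add: measure_def)
  have T' [measurable]: "T' \<in> measurable M M"
  proof (rule measurableI)
    fix A assume A: "A \<in> sets M"
    have "T' -` A \<inter> space M = (T -` A \<inter> space M) \<union> (A \<inter> (space M - (T -` space M \<inter> space M)))"
      using sets.sets_into_space[OF A] by (auto simp: T'_def split: if_splits)
    also have "\<dots> \<in> sets M" using inv(1)[OF A] A good(1) by auto
    finally show "T' -` A \<inter> space M \<in> sets M" .
  qed (auto simp: T'_def)
  have AE_eq: "AE x in M. T' x = T x" using AE_good by eventually_elim (simp add: T'_def)
  have "distr M M T' = M"
  proof (rule measure_eqI)
    fix A assume "A \<in> sets (distr M M T')"
    then have A: "A \<in> sets M" by simp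
    have "emeasure (distr M M T') A = emeasure M (T' -` A \<inter> space M)"
      by (rule emeasure_distr) (use A in auto)
    also have "\<dots> = emeasure M (T -` A \<inter> space M)"
      by (rule emeasure_eq_AE) (use AE_eq inv(1)[OF A] measurable_sets[OF T' A] in \<open>auto elim!: eventually_mono\<close>)
    finally show "emeasure (distr M M T') A = emeasure M A" using inv(2)[OF A] by simp
  qed simp
  then show thesis using that T' AE_eq by blast
qed

lemma distr_iterate:
  assumes "T \<in> measurable M M" "distr M M T = M"
  shows "distr M M (T ^^ n) = M"
proof (induction n)
  case 0
  show ?case by (simp add: id_def distr_id)
next
  case (Suc n)
  have "distr M M (T ^^ Suc n) = distr M M (T \<circ> T ^^ n)" by simp
  also have "\<dots> = distr (distr M M (T ^^ n)) M T"
    using assms(1) by (intro distr_distr[symmetric] measurable_compose_n)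
  finally show ?case by (simp only: Suc assms(2))
qed

lemma AE_iterate:
  assumes T: "T \<in> measurable M M" "distr M M T = M" and "AE x in M. P x"
  shows "AE x in M. \<forall>n. P ((T ^^ n) x)"
proof (rule AE_all_countable[THEN iffD2], rule allI)
  fix n
  have "AE x in distr M M (T ^^ n). P x" using assms(3) unfolding distr_iterate[OF T] .
  then show "AE x in M. P ((T ^^ n) x)" by (intro AE_distrD[of "T ^^ n" M M] measurable_compose_n T(1))
qed

text \<open>Almost sure limits determine the integrals of bounded continuous functions, and the indicator of an open set
  \<open>U\<close> is the increasing limit of the functions \<open>min 1 (k d(\<cdot>, - U))\<close>.\<close>

lemma distr_eq_of_AE_limits:
  fixes Y :: "nat \<Rightarrow> 'a \<Rightarrow> 'c :: metric_space" and Z :: "nat \<Rightarrow> 'b \<Rightarrow> 'c"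
  assumes K: "prob_space K" and L: "prob_space L"
    and Y [measurable]: "\<And>n. Y n \<in> borel_measurable K" and Z [measurable]: "\<And>n. Z n \<in> borel_measurable L"
    and Y' [measurable]: "Y' \<in> borel_measurable K" and Z' [measurable]: "Z' \<in> borel_measurable L"
    and eq: "\<And>n. distr K borel (Y n) = distr L borel (Z n)"
    and limY: "AE x in K. (\<lambda>n. Y n x) \<longlonglongrightarrow> Y' x"
    and limZ: "AE x in L. (\<lambda>n. Z n x) \<longlonglongrightarrow> Z' x"
  shows "distr K borel Y' = distr L borel Z'"
proof -
  interpret K: prob_space K by fact
  interpret L: prob_space L by fact
  interpret KY: prob_space "distr K borel Y'" by (rule K.prob_space_distr) simp
  interpret LZ: prob_space "distr L borel Z'" by (rule L.prob_space_distr) simp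
  have cont: "(\<integral>x. g (Y' x) \<partial>K) = (\<integral>x. g (Z' x) \<partial>L)"
    if g: "continuous_on UNIV g" "\<And>p. \<bar>g p\<bar> \<le> 1" for g :: "'c \<Rightarrow> real"
  proof -
    have [measurable]: "g \<in> borel_measurable borel" using g(1) by (rule borel_measurable_continuous_onI)
    have lim: "(\<lambda>n. g (f n)) \<longlonglongrightarrow> g l" if "f \<longlonglongrightarrow> l" for f l
      using continuous_on_tendsto_compose[OF g(1) that] by simp
    have "(\<lambda>n. \<integral>x. g (Y n x) \<partial>K) \<longlonglongrightarrow> (\<integral>x. g (Y' x) \<partial>K)"
      by (rule integral_dominated_convergence[where w = "\<lambda>_. 1"])
        (use g limY in \<open>auto elim!: eventually_mono intro: lim\<close>)
    moreover have "(\<lambda>n. \<integral>x. g (Z n x) \<partial>L) \<longlonglongrightarrow> (\<integral>x. g (Z' x) \<partial>L)"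
      by (rule integral_dominated_convergence[where w = "\<lambda>_. 1"])
        (use g limZ in \<open>auto elim!: eventually_mono intro: lim\<close>)
    moreover have "(\<integral>x. g (Y n x) \<partial>K) = (\<integral>x. g (Z n x) \<partial>L)" for n
      using integral_distr[of "Y n" K borel g] integral_distr[of "Z n" L borel g] by (simp add: eq)
    ultimately show ?thesis by (simp only:) (rule LIMSEQ_unique)
  qed
  have on_open: "emeasure (distr K borel Y') U = emeasure (distr L borel Z') U" if U: "open U" for U
  proof (cases "U = UNIV")
    case True
    then show ?thesis using KY.emeasure_space_1 LZ.emeasure_space_1 by simp
  next
    case False
    have [measurable]: "U \<in> sets borel" using U by simp
    define g where "g k p = min 1 (real k * infdist p (- U))" for k p
    have g: "continuous_on UNIV (g k)" "\<bar>g k p\<bar> \<le> 1" for k p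
      unfolding g_def by (auto intro!: continuous_intros simp: infdist_nonneg)
    have [measurable]: "g k \<in> borel_measurable borel" for k using g(1) by (rule borel_measurable_continuous_onI)
    have glim: "(\<lambda>k. g k p) \<longlonglongrightarrow> indicator U p" for p
    proof (cases "p \<in> U")
      case True
      then have pos: "0 < infdist p (- U)"
        using U False by (intro infdist_pos_not_in_closed) auto
      obtain k0 :: nat where k0: "1 / infdist p (- U) \<le> real k0" using real_arch_simple by blast
      have "\<forall>\<^sub>F k in sequentially. g k p = 1"
        using eventually_ge_at_top[of k0]
      proof eventually_elim
        case (elim k)
        then have "1 / infdist p (- U) \<le> real k" using k0 by linarith
        then have "1 \<le> real k * infdist p (- U)" using pos by (simp add: field_simps)
        then show ?case by (simp add: g_def)
      qed
      then show ?thesis using True by (simp add: tendsto_eventually)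
    next
      case False
      then show ?thesis by (simp add: g_def)
    qed
    have "(\<lambda>k. \<integral>x. g k (Y' x) \<partial>K) \<longlonglongrightarrow> (\<integral>x. indicator U (Y' x) \<partial>K)"
      by (rule integral_dominated_convergence[where w = "\<lambda>_. 1"]) (use g glim in auto)
    moreover have "(\<lambda>k. \<integral>x. g k (Z' x) \<partial>L) \<longlonglongrightarrow> (\<integral>x. indicator U (Z' x) \<partial>L)"
      by (rule integral_dominated_convergence[where w = "\<lambda>_. 1"]) (use g glim in auto)
    ultimately have "(\<integral>x. indicator U (Y' x) \<partial>K) = (\<integral>x. indicator U (Z' x) \<partial>L :: real)"
      unfolding cont[OF g] by (rule LIMSEQ_unique)
    then have "(\<integral>p. indicator U p \<partial>distr K borel Y') = (\<integral>p. indicator U p \<partial>distr L borel Z' :: real)"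
      by (subst (1 2) integral_distr) simp_all
    then have "measure (distr K borel Y') U = measure (distr L borel Z') U" by simp
    then show ?thesis by (simp add: KY.emeasure_eq_measure LZ.emeasure_eq_measure)
  qed
  show ?thesis
  proof (rule measure_eqI_generator_eq[where E = "{U. open U}" and \<Omega> = UNIV and A = "\<lambda>_. UNIV"])
    show "Int_stable {U :: 'c set. open U}" by (auto simp: Int_stable_def)
    show "sets (distr K borel Y') = sigma_sets UNIV {U. open U}" by (simp add: borel_def)
    show "sets (distr L borel Z') = sigma_sets UNIV {U. open U}" by (simp add: borel_def)
  qed (use on_open in auto)
qed

context alpha_cf
begin

section \<open>The measures on Omega and on the interval\<close>

lemma space_mu_alpha_eq [simp]: "space (mu_alpha \<alpha>) = Omega \<alpha>"
  by (rule space_mu_alpha[OF alpha_pos alpha_le_1])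

lemma sets_mu_alpha_iff: "A \<in> sets (mu_alpha \<alpha>) \<longleftrightarrow> A \<in> sets borel \<and> A \<subseteq> Omega \<alpha>"
  unfolding sets_mu_alpha[OF alpha_pos alpha_le_1] by (subst sets_restrict_space_iff) auto

lemma space_nu_alpha_eq [simp]: "space (nu_alpha \<alpha>) = Ival \<alpha>"
  by (rule space_nu_alpha)

lemma sets_nu_alpha_iff: "A \<in> sets (nu_alpha \<alpha>) \<longleftrightarrow> A \<in> sets borel \<and> A \<subseteq> Ival \<alpha>"
  unfolding sets_nu_alpha by (subst sets_restrict_space_iff) (auto simp: Ival_def)

lemma emeasure_mu:
  assumes A: "A \<in> sets borel" "A \<subseteq> Ival \<alpha> \<times> {0..1}"
  shows "emeasure (mu \<alpha>) A = emeasure cf_measure A"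
proof -
  have X: "Ival \<alpha> \<times> {0..1::real} \<in> sets borel" unfolding Ival_def by (intro borel_Times) auto
  have w: "(\<lambda>(x, y). ennreal (1 / (1 + x * y)\<^sup>2)) = cf_weight"
    by (auto simp: cf_weight_def fun_eq_iff)
  have "emeasure (mu \<alpha>) A = (\<integral>\<^sup>+p. cf_weight p * indicator A p \<partial>restrict_space lborel (Ival \<alpha> \<times> {0..1}))"
    unfolding mu_def w
    using A X by (intro emeasure_density) (auto simp: sets_restrict_space_iff intro!: measurable_restrict_space1)
  also have "\<dots> = (\<integral>\<^sup>+p. cf_weight p * indicator A p * indicator (Ival \<alpha> \<times> {0..1}) p \<partial>lborel)"
    using X by (intro nn_integral_restrict_space) simp
  also have "\<dots> = (\<integral>\<^sup>+p. cf_weight p * indicator A p \<partial>lborel)"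
    using A(2) by (intro nn_integral_cong) (auto split: split_indicator)
  also have "\<dots> = emeasure cf_measure A"
    unfolding cf_measure_def using A by (intro emeasure_density[symmetric]) auto
  finally show ?thesis .
qed

lemma emeasure_mu_alpha:
  assumes A: "A \<in> sets borel" "A \<subseteq> Omega \<alpha>"
  shows "emeasure (mu_alpha \<alpha>) A = emeasure cf_measure A / emeasure cf_measure (Omega \<alpha>)"
proof -
  have sub: "Omega \<alpha> \<subseteq> space (mu \<alpha>)"
    using Omega_bounds by (auto simp: mu_def space_restrict_space)
  have X: "Ival \<alpha> \<times> {0..1::real} \<in> sets borel" unfolding Ival_def by (intro borel_Times) auto
  have "Omega \<alpha> \<in> sets (mu \<alpha>)"
    using Omega_bounds X by (simp add: mu_def sets_restrict_space_iff)
  then have "emeasure (mu_alpha \<alpha>) A = 1 / emeasure (mu \<alpha>) (Omega \<alpha>) * emeasure (mu \<alpha>) A"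
    unfolding mu_alpha_def using A sub by (simp add: emeasure_restrict_space Int_absorb2)
  also have "\<dots> = emeasure cf_measure A / emeasure cf_measure (Omega \<alpha>)"
    using A Omega_bounds by (simp add: emeasure_mu ennreal_divide_times)
  finally show ?thesis .
qed

lemma prob_space_mu_alpha: "prob_space (mu_alpha \<alpha>)"
proof (rule prob_spaceI)
  show "emeasure (mu_alpha \<alpha>) (space (mu_alpha \<alpha>)) = 1"
    using emeasure_mu_alpha[of "Omega \<alpha>"] emeasure_Omega_pos emeasure_Omega_finite
    by (simp add: ennreal_divide_self top.not_eq_extremum)
qed

lemma AE_mu_alphaI:
  assumes "AE p in cf_measure. p \<in> Omega \<alpha> \<longrightarrow> P p"
  shows "AE p in mu_alpha \<alpha>. P p"
proof -
  obtain Z where Z: "{p \<in> space cf_measure. \<not> (p \<in> Omega \<alpha> \<longrightarrow> P p)} \<subseteq> Z" "emeasure cf_measure Z = 0" "Z \<in> sets cf_measure"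
    using assms by (rule AE_E)
  show ?thesis
  proof (rule AE_I[of _ _ "Z \<inter> Omega \<alpha>"])
    show "{p \<in> space (mu_alpha \<alpha>). \<not> P p} \<subseteq> Z \<inter> Omega \<alpha>" using Z(1) by auto
    have "Z \<inter> Omega \<alpha> \<in> null_sets cf_measure" using Z by (intro null_set_Int2) (auto simp: null_sets_def)
    then show "emeasure (mu_alpha \<alpha>) (Z \<inter> Omega \<alpha>) = 0" using Z(3) by (subst emeasure_mu_alpha) (auto simp: null_sets_def)
    show "Z \<inter> Omega \<alpha> \<in> sets (mu_alpha \<alpha>)" using Z(3) by (simp add: sets_mu_alpha_iff)
  qed
qed

lemma measure_preserving_mu_alphaI:
  assumes T: "T \<in> borel_measurable borel"
    and inv: "\<And>E. E \<in> sets borel \<Longrightarrow> emeasure cf_measure (Omega \<alpha> \<inter> T -` E) = emeasure cf_measure (Omega \<alpha> \<inter> E)"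
  shows "measure_preserving_system (mu_alpha \<alpha>) T"
  unfolding measure_preserving_system_def
proof (intro conjI ballI prob_space_mu_alpha)
  fix A assume "A \<in> sets (mu_alpha \<alpha>)"
  then have A: "A \<in> sets borel" "A \<subseteq> Omega \<alpha>" by (auto simp: sets_mu_alpha_iff)
  have TA: "T -` A \<in> sets borel" using measurable_sets[OF T A(1)] by simp
  show "T -` A \<inter> space (mu_alpha \<alpha>) \<in> sets (mu_alpha \<alpha>)" using TA by (simp add: sets_mu_alpha_iff)
  show "emeasure (mu_alpha \<alpha>) (T -` A \<inter> space (mu_alpha \<alpha>)) = emeasure (mu_alpha \<alpha>) A"
    using TA A inv[OF A(1)] by (simp add: emeasure_mu_alpha Int_commute Int_absorb1 Int_absorb2)
qed

lemma planar_map_measure_preserving: "measure_preserving_system (mu_alpha \<alpha>) (planar_map \<alpha>)"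
  by (intro measure_preserving_mu_alphaI planar_map_preserves_cf_measure) simp_all

lemma invertible_mu_alpha: "invertible_system (mu_alpha \<alpha>) (planar_map \<alpha>)"
  unfolding invertible_system_def
proof (intro conjI exI[of _ inverse_map])
  show "measure_preserving_system (mu_alpha \<alpha>) inverse_map"
    by (intro measure_preserving_mu_alphaI inverse_map_preserves_cf_measure) simp_all
qed (intro planar_map_measure_preserving AE_mu_alphaI AE_inverse_map_planar_map AE_planar_map_inverse_map)+

lemma fst_measurable: "fst \<in> measurable (mu_alpha \<alpha>) (nu_alpha \<alpha>)"
proof (rule measurableI)
  show "fst p \<in> space (nu_alpha \<alpha>)" if "p \<in> space (mu_alpha \<alpha>)" for p using that Omega_bounds by auto
  have [measurable]: "(fst :: real \<times> real \<Rightarrow> real) \<in> borel_measurable borel"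
    by (simp add: borel_prod[symmetric])
  show "fst -` A \<inter> space (mu_alpha \<alpha>) \<in> sets (mu_alpha \<alpha>)" if "A \<in> sets (nu_alpha \<alpha>)" for A
    using that measurable_sets[of "fst :: real \<times> real \<Rightarrow> real" borel borel A] by (simp add: sets_mu_alpha_iff sets_nu_alpha_iff)
qed

text \<open>By Fubini the density of the projected measure at \<open>x\<close> is the integral over the fibre.\<close>

lemma distr_fst: "distr (mu_alpha \<alpha>) (nu_alpha \<alpha>) fst = nu_alpha \<alpha>"
proof (rule measure_eqI)
  fix A assume "A \<in> sets (distr (mu_alpha \<alpha>) (nu_alpha \<alpha>) fst)"
  then have AN: "A \<in> sets (nu_alpha \<alpha>)" and A [measurable]: "A \<in> sets borel" and A_sub: "A \<subseteq> Ival \<alpha>" by (auto simp: sets_nu_alpha_iff)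
  define c where "c = emeasure cf_measure (Omega \<alpha>)"
  have mu_c: "emeasure (mu \<alpha>) (Omega \<alpha>) = c" unfolding c_def by (rule emeasure_mu) (use Omega_bounds in auto)
  have I [measurable]: "Ival \<alpha> \<in> sets borel" by (simp add: Ival_def)
  have [measurable]: "Omega \<alpha> \<in> sets (borel \<Otimes>\<^sub>M borel)" "cf_weight \<in> borel_measurable (borel \<Otimes>\<^sub>M borel)"
    using measurable_sets_cf(2) cf_weight_measurable unfolding borel_prod[symmetric] by blast+
  define h where "h x = (\<integral>\<^sup>+y. cf_weight (x, y) * indicator (Omega \<alpha>) (x, y) \<partial>lborel)" for x
  have [measurable]: "h \<in> borel_measurable borel" unfolding h_def by measurable
  have N_h: "(nu_alpha \<alpha>) = density (restrict_space lborel (Ival \<alpha>)) (\<lambda>x. h x / c)"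
    unfolding nu_alpha_def mu_c h_def cf_weight_def
    by (intro arg_cong[where f = "density _"] ext arg_cong2[where f = "(/)"] nn_integral_cong refl) (auto split: split_indicator)
  have fA: "fst -` A \<inter> Omega \<alpha> \<in> sets borel" using measurable_sets[OF fst_measurable AN] by (simp add: sets_mu_alpha_iff)
  have "emeasure (distr (mu_alpha \<alpha>) (nu_alpha \<alpha>) fst) A = emeasure (mu_alpha \<alpha>) (fst -` A \<inter> Omega \<alpha>)"
    using emeasure_distr[OF fst_measurable AN] by simp
  also have "\<dots> = emeasure cf_measure (fst -` A \<inter> Omega \<alpha>) / c"
    unfolding c_def by (rule emeasure_mu_alpha[OF fA]) simp
  also have "emeasure cf_measure (fst -` A \<inter> Omega \<alpha>)
      = (\<integral>\<^sup>+p. cf_weight p * indicator (fst -` A \<inter> Omega \<alpha>) p \<partial>lborel)"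
    unfolding cf_measure_def using fA by (intro emeasure_density) auto
  also have "\<dots> = (\<integral>\<^sup>+p. cf_weight p * indicator (Omega \<alpha>) p * indicator A (fst p) \<partial>(lborel \<Otimes>\<^sub>M lborel))"
    unfolding lborel_prod by (intro nn_integral_cong) (auto split: split_indicator)
  also have "\<dots> = (\<integral>\<^sup>+x. \<integral>\<^sup>+y. cf_weight (x, y) * indicator (Omega \<alpha>) (x, y) * indicator A x \<partial>lborel \<partial>lborel)"
    by (subst lborel.nn_integral_fst[symmetric]) simp_all
  also have "\<dots> = (\<integral>\<^sup>+x. h x * indicator A x \<partial>lborel)"
    unfolding h_def by (intro nn_integral_cong nn_integral_multc) measurable
  also have "\<dots> / c = (\<integral>\<^sup>+x. h x * indicator A x / c \<partial>lborel)"
    by (rule nn_integral_divide[symmetric]) simp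
  also have "\<dots> = (\<integral>\<^sup>+x. h x / c * indicator A x * indicator (Ival \<alpha>) x \<partial>lborel)"
    using A_sub by (intro nn_integral_cong) (auto split: split_indicator)
  also have "\<dots> = (\<integral>\<^sup>+x. h x / c * indicator A x \<partial>restrict_space lborel (Ival \<alpha>))"
    by (rule nn_integral_restrict_space[symmetric]) simp
  also have "\<dots> = emeasure (nu_alpha \<alpha>) A"
    unfolding N_h
    by (rule emeasure_density[symmetric])
      (use A_sub in \<open>auto simp: sets_restrict_space_iff intro!: measurable_restrict_space1\<close>)
  finally show "emeasure (distr (mu_alpha \<alpha>) (nu_alpha \<alpha>) fst) A = emeasure (nu_alpha \<alpha>) A" .
qed simp

lemma fst_image_Omega: "fst ` Omega \<alpha> = Ival \<alpha>"
proof
  show "fst ` Omega \<alpha> \<subseteq> Ival \<alpha>" using Omega_bounds by auto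
  have "x \<in> fst ` Omega \<alpha>" if "x \<in> {\<alpha> - 1..<\<alpha>}" for x
  proof -
    have "(planar_map \<alpha> ^^ 0) (x, 0) \<in> orbit_set" unfolding orbit_set_def using that by blast
    then show ?thesis using orbit_set_subset_Omega by (force simp: image_iff)
  qed
  then have "{\<alpha> - 1..<\<alpha>} \<subseteq> fst ` Omega \<alpha>" by blast
  moreover have "closed (fst ` Omega \<alpha>)"
    by (intro compact_imp_closed compact_continuous_image compact_Omega continuous_intros)
  ultimately have "closure {\<alpha> - 1..<\<alpha>} \<subseteq> fst ` Omega \<alpha>" by (rule closure_minimal)
  then show "Ival \<alpha> \<subseteq> fst ` Omega \<alpha>" by (simp add: Ival_def)
qed

text \<open>Invariance passes to the factor: the preimage of \<open>A\<close> under \<open>cf_map \<alpha>\<close>, lifted to \<open>Omega \<alpha>\<close>, is almost the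
  preimage under \<open>planar_map \<alpha>\<close> of the lift of \<open>A\<close>.\<close>

lemma cf_map_measure_preserving: "measure_preserving_system (nu_alpha \<alpha>) (cf_map \<alpha>)"
  unfolding measure_preserving_system_def
proof (intro conjI ballI)
  interpret prob_space "mu_alpha \<alpha>" by (rule prob_space_mu_alpha)
  show "prob_space (nu_alpha \<alpha>)" using prob_space_distr[OF fst_measurable] by (simp add: distr_fst)
  fix A assume A: "A \<in> sets (nu_alpha \<alpha>)"
  have TA: "cf_map \<alpha> -` A \<inter> space (nu_alpha \<alpha>) \<in> sets (nu_alpha \<alpha>)"
    using A measurable_sets[OF measurable_cf(2), of A] by (simp add: sets_nu_alpha_iff Ival_def)
  then show "cf_map \<alpha> -` A \<inter> space (nu_alpha \<alpha>) \<in> sets (nu_alpha \<alpha>)" .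
  have emN: "emeasure (nu_alpha \<alpha>) E = emeasure (mu_alpha \<alpha>) (fst -` E \<inter> Omega \<alpha>)" if "E \<in> sets (nu_alpha \<alpha>)" for E
    using emeasure_distr[OF fst_measurable that] by (simp add: distr_fst)
  have AM: "fst -` A \<inter> Omega \<alpha> \<in> sets (mu_alpha \<alpha>)" using measurable_sets[OF fst_measurable A] by simp
  have pM: "planar_map \<alpha> -` (fst -` A \<inter> Omega \<alpha>) \<inter> Omega \<alpha> \<in> sets (mu_alpha \<alpha>)"
    "emeasure (mu_alpha \<alpha>) (planar_map \<alpha> -` (fst -` A \<inter> Omega \<alpha>) \<inter> Omega \<alpha>) = emeasure (mu_alpha \<alpha>) (fst -` A \<inter> Omega \<alpha>)"
    using planar_map_measure_preserving AM by (auto simp: measure_preserving_system_def)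
  have sTA: "fst -` (cf_map \<alpha> -` A \<inter> space (nu_alpha \<alpha>)) \<inter> Omega \<alpha> \<in> sets (mu_alpha \<alpha>)"
    using measurable_sets[OF fst_measurable TA] by simp
  have "emeasure (nu_alpha \<alpha>) (cf_map \<alpha> -` A \<inter> space (nu_alpha \<alpha>)) = emeasure (mu_alpha \<alpha>) (fst -` (cf_map \<alpha> -` A \<inter> space (nu_alpha \<alpha>)) \<inter> Omega \<alpha>)"
    by (rule emN[OF TA])
  also have "\<dots> = emeasure (mu_alpha \<alpha>) (planar_map \<alpha> -` (fst -` A \<inter> Omega \<alpha>) \<inter> Omega \<alpha>)"
  proof (rule emeasure_eq_AE[OF _ sTA pM(1)])
    have "AE p in cf_measure. p \<in> Omega \<alpha> \<longrightarrow> planar_map \<alpha> p \<in> Omega \<alpha>"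
      using AE_not_in_vertical_lines[OF countable_singular] by eventually_elim (use planar_map_Omega in blast)
    then have "AE p in mu_alpha \<alpha>. planar_map \<alpha> p \<in> Omega \<alpha>" by (rule AE_mu_alphaI)
    then show "AE p in mu_alpha \<alpha>. p \<in> fst -` (cf_map \<alpha> -` A \<inter> space (nu_alpha \<alpha>)) \<inter> Omega \<alpha>
        \<longleftrightarrow> p \<in> planar_map \<alpha> -` (fst -` A \<inter> Omega \<alpha>) \<inter> Omega \<alpha>"
      by eventually_elim (use Omega_bounds in \<open>auto simp: fst_planar_map\<close>)
  qed
  also have "\<dots> = emeasure (nu_alpha \<alpha>) A" using pM(2) emN[OF A] by simp
  finally show "emeasure (nu_alpha \<alpha>) (cf_map \<alpha> -` A \<inter> space (nu_alpha \<alpha>)) = emeasure (nu_alpha \<alpha>) A" .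
qed

end

section \<open>Minimality\<close>

lemma invertible_system_inverse:
  assumes "invertible_system K R"
  obtains S where "S \<in> measurable K K" "distr K K S = K"
    "AE z in K. S (R z) = z" "AE z in K. R (S z) = z"
proof -
  obtain S0 where R: "measure_preserving_system K R" and S0: "measure_preserving_system K S0"
    and inv: "AE z in K. S0 (R z) = z" "AE z in K. R (S0 z) = z"
    using assms by (auto simp: invertible_system_def)
  obtain R' where R': "R' \<in> measurable K K" "distr K K R' = K" "AE z in K. R' z = R z"
    using measure_preserving_total_version[OF R] .
  obtain S where S: "S \<in> measurable K K" "distr K K S = K" "AE z in K. S z = S0 z"
    using measure_preserving_total_version[OF S0] .
  have "AE z in distr K K R'. S z = S0 z" using S(3) unfolding R'(2) .
  then have "AE z in K. S (R' z) = S0 (R' z)" using R'(1) by (rule AE_distrD[rotated])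
  then have "AE z in K. S (R z) = z" using R'(3) inv(1) by eventually_elim simp
  moreover have "AE z in K. R (S z) = z" using S(3) inv(2) by eventually_elim simp
  ultimately show thesis using that S by blast
qed

context alpha_cf
begin

text \<open>Index \<open>n\<close> counts backwards in time: \<open>x 0\<close> is the present and \<open>x n\<close> lies \<open>n\<close> steps in the past.\<close>

definition history :: "(nat \<Rightarrow> real) \<Rightarrow> bool" where
  "history x \<longleftrightarrow> (\<forall>n. x n \<in> Ival \<alpha> \<and> x n = cf_map \<alpha> (x (Suc n)))"

text \<open>The unknown height \<open>n\<close> steps ago is replaced by \<open>0\<close>; by contraction, the height obtained now depends on
  this choice by at most \<open>1 / (n + 1)\<close>.\<close>

definition past_point :: "(nat \<Rightarrow> real) \<Rightarrow> nat \<Rightarrow> real \<times> real" where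
  "past_point x n = (planar_map \<alpha> ^^ n) (x n, 0)"

definition past_limit :: "(nat \<Rightarrow> real) \<Rightarrow> real" where
  "past_limit x = lim (\<lambda>n. snd (past_point x n))"

lemma history_in: "history x \<Longrightarrow> x n \<in> Ival \<alpha>"
  unfolding history_def by blast

lemma history_step: "history x \<Longrightarrow> x n = cf_map \<alpha> (x (Suc n))"
  unfolding history_def by blast

lemma history_iterate:
  assumes "history x" "y \<in> {0..1}"
  shows "\<exists>y'\<in>{0..1}. (planar_map \<alpha> ^^ k) (x (n + k), y) = (x n, y')"
  using assms(2)
proof (induction k arbitrary: y)
  case 0
  then show ?case by auto
next
  case (Suc k)
  have xI: "x (Suc (n + k)) \<in> Ival \<alpha>" "x (n + k) = cf_map \<alpha> (x (Suc (n + k)))"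
    using history_in[OF assms(1)] history_step[OF assms(1)] by blast+
  define y1 where "y1 = snd (planar_map \<alpha> (x (Suc (n + k)), y))"
  have step: "planar_map \<alpha> (x (Suc (n + k)), y) = (x (n + k), y1)"
    using fst_planar_map[of "(x (Suc (n + k)), y)"] xI(2) by (simp add: y1_def prod_eq_iff)
  have "planar_map \<alpha> (x (Suc (n + k)), y) \<in> Ival \<alpha> \<times> {0..1}"
    using planar_map_in[OF alpha_pos alpha_le_1] xI(1) Suc.prems by blast
  then have "y1 \<in> {0..1}" by (simp add: step)
  from Suc.IH[OF this] show ?case by (simp add: funpow_Suc_right step del: funpow.simps)
qed

lemma past_point_cauchy:
  assumes "history x"
  shows "\<bar>snd (past_point x (n + k)) - snd (past_point x n)\<bar> \<le> 1 / (1 + real n)"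
proof -
  obtain y where y: "y \<in> {0..1}" "(planar_map \<alpha> ^^ k) (x (n + k), 0) = (x n, y)"
    using history_iterate[OF assms, of 0 k n] by auto
  have "past_point x (n + k) = (planar_map \<alpha> ^^ n) (x n, y)"
    by (simp add: past_point_def funpow_add y)
  then show ?thesis
    using fibre_contraction[of "x n" y 0 n] history_in[OF assms] y(1) by (simp add: past_point_def)
qed

lemma past_point_in:
  assumes "history x"
  shows "fst (past_point x n) = x 0" "0 \<le> snd (past_point x n)" "snd (past_point x n) \<le> 1"
  using history_iterate[OF assms, of 0 n 0] by (auto simp: past_point_def)

lemma past_point_tendsto:
  assumes x: "history x"
  shows "past_point x \<longlonglongrightarrow> (x 0, past_limit x)"
proof -
  have "Cauchy (\<lambda>n. snd (past_point x n))"
  proof (rule metric_CauchyI)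
    fix e :: real assume "0 < e"
    then obtain m where m: "1 / real (Suc m) < e / 2"
      using reals_Archimedean[of "e / 2"] by (auto simp: inverse_eq_divide)
    have close: "\<bar>snd (past_point x i) - snd (past_point x m)\<bar> < e / 2" if "m \<le> i" for i
      using past_point_cauchy[OF x, of m "i - m"] that m by simp
    have "dist (snd (past_point x i)) (snd (past_point x j)) < e" if "m \<le> i" "m \<le> j" for i j
      using close[OF that(1)] close[OF that(2)] unfolding dist_real_def by linarith
    then show "\<exists>m. \<forall>i\<ge>m. \<forall>j\<ge>m. dist (snd (past_point x i)) (snd (past_point x j)) < e" by blast
  qed
  then have "(\<lambda>n. snd (past_point x n)) \<longlonglongrightarrow> past_limit x"
    unfolding past_limit_def by (simp add: Cauchy_convergent_iff convergent_LIMSEQ_iff)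
  then have "(\<lambda>n. (x 0, snd (past_point x n))) \<longlonglongrightarrow> (x 0, past_limit x)"
    by (intro tendsto_Pair tendsto_const)
  moreover have "(x 0, snd (past_point x n)) = past_point x n" for n
    using past_point_in(1)[OF x] by (metis prod.collapse)
  ultimately show ?thesis by simp
qed

lemma past_limit_bounds:
  assumes "history x"
  shows "past_limit x \<in> {0..1}"
proof -
  have lim: "(\<lambda>n. snd (past_point x n)) \<longlonglongrightarrow> past_limit x"
    using tendsto_snd[OF past_point_tendsto[OF assms]] by simp
  show ?thesis
    using LIMSEQ_le_const[OF lim, of 0] LIMSEQ_le_const2[OF lim, of 1] past_point_in[OF assms] by auto
qed

lemma past_limit_in_Omega:
  assumes "history x" "\<And>n. x n < \<alpha>"
  shows "(x 0, past_limit x) \<in> Omega \<alpha>"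
proof -
  have "x n \<in> {\<alpha> - 1..<\<alpha>}" for n using history_in[OF assms(1), of n] assms(2)[of n] by (simp add: Ival_def)
  then have "past_point x n \<in> Omega \<alpha>" for n
    using orbit_set_subset_Omega unfolding past_point_def orbit_set_def by blast
  then show ?thesis
    using closed_sequentially[OF compact_imp_closed[OF compact_Omega] _ past_point_tendsto[OF assms(1)]] by blast
qed

text \<open>Appending the new present \<open>cf_map \<alpha> (x 0)\<close> to a past moves the limit point by \<open>planar_map \<alpha>\<close>, because the map
  is continuous along each vertical fibre.\<close>

lemma past_limit_shift:
  assumes x: "history x" and x': "history x'" and shift: "\<And>n. x' (Suc n) = x n"
  shows "planar_map \<alpha> (x 0, past_limit x) = (x' 0, past_limit x')"
proof -
  have x'0: "x' 0 = cf_map \<alpha> (x 0)" using history_step[OF x', of 0] by (simp add: shift)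
  have step: "past_point x' (Suc n) = planar_map \<alpha> (past_point x n)" for n
    by (simp add: past_point_def shift)
  have pp: "past_point x n = (x 0, snd (past_point x n))" for n
    using past_point_in(1)[OF x] by (metis prod.collapse)
  have lim: "(\<lambda>n. snd (past_point x n)) \<longlonglongrightarrow> past_limit x"
    using tendsto_snd[OF past_point_tendsto[OF x]] by simp
  have "(\<lambda>n. planar_map \<alpha> (past_point x n)) \<longlonglongrightarrow> planar_map \<alpha> (x 0, past_limit x)"
  proof (cases "x 0 = 0")
    case True
    then show ?thesis by (subst pp) (simp add: planar_map_pair)
  next
    case False
    have "1 \<le> of_int (digit \<alpha> (x 0)) + eps (x 0) * past_limit x"
      using past_limit_bounds[OF x] history_in[OF x] False by (intro denominator_ge_1) auto
    then have "(\<lambda>n. (cf_map \<alpha> (x 0), 1 / (of_int (digit \<alpha> (x 0)) + eps (x 0) * snd (past_point x n))))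
        \<longlonglongrightarrow> (cf_map \<alpha> (x 0), 1 / (of_int (digit \<alpha> (x 0)) + eps (x 0) * past_limit x))"
      by (intro tendsto_intros lim) auto
    then show ?thesis using False by (subst pp) (simp add: planar_map_pair)
  qed
  moreover have "(\<lambda>n. planar_map \<alpha> (past_point x n)) \<longlonglongrightarrow> (x' 0, past_limit x')"
    using LIMSEQ_Suc[OF past_point_tendsto[OF x']] by (simp add: step)
  ultimately show ?thesis by (rule LIMSEQ_unique)
qed

lemma AE_history:
  assumes S: "S \<in> measurable K K" "distr K K S = K" and RS: "AE z in K. R (S z) = z"
    and q: "factor_map K R (nu_alpha \<alpha>) (cf_map \<alpha>) q"
  shows "AE z in K. history (\<lambda>n. q ((S ^^ n) z))"
proof -
  have qm: "q \<in> measurable K (nu_alpha \<alpha>)" and eq: "AE z in K. q (R z) = cf_map \<alpha> (q z)"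
    using q by (auto simp: factor_map_def)
  show ?thesis
    using AE_iterate[OF S RS] AE_iterate[OF S eq] AE_space
  proof eventually_elim
    case (elim z)
    have "(S ^^ n) z \<in> space K" for n
      using measurable_space[OF measurable_compose_n[OF S(1)] elim(3)] .
    then have "q ((S ^^ n) z) \<in> Ival \<alpha>" for n using measurable_space[OF qm] by auto
    moreover have "q ((S ^^ n) z) = cf_map \<alpha> (q ((S ^^ Suc n) z))" for n
      using elim(1)[rule_format, of n] elim(2)[rule_format, of "Suc n"] by simp
    ultimately show ?case unfolding history_def by blast
  qed
qed

text \<open>The position \<open>n\<close> steps in the past has law \<open>nu_alpha \<alpha>\<close>, so the law of the approximation does not involve
  the system \<open>K\<close>.\<close>

lemma past_point_distribution:
  assumes S: "S \<in> measurable K K" "distr K K S = K"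
    and q: "q \<in> measurable K (nu_alpha \<alpha>)" "distr K (nu_alpha \<alpha>) q = nu_alpha \<alpha>"
  shows "(\<lambda>z. past_point (\<lambda>n. q ((S ^^ n) z)) n) \<in> borel_measurable K"
    and "distr K borel (\<lambda>z. past_point (\<lambda>n. q ((S ^^ n) z)) n) = distr (nu_alpha \<alpha>) borel (\<lambda>x. (planar_map \<alpha> ^^ n) (x, 0))"
proof -
  have Sn: "S ^^ n \<in> measurable K K" using S(1) by (rule measurable_compose_n)
  have qS: "q \<circ> S ^^ n \<in> measurable K (nu_alpha \<alpha>)" using Sn q(1) by (rule measurable_comp)
  have id_meas: "(\<lambda>x. x) \<in> borel_measurable (nu_alpha \<alpha>)"
    unfolding measurable_cong_sets[OF sets_nu_alpha refl] by (rule measurable_restrict_space1) simp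
  have [measurable]: "planar_map \<alpha> ^^ n \<in> borel_measurable borel"
    by (rule measurable_compose_n) simp
  have f: "(\<lambda>x. (planar_map \<alpha> ^^ n) (x, 0)) \<in> borel_measurable (nu_alpha \<alpha>)"
    using id_meas by measurable
  have eq: "(\<lambda>z. past_point (\<lambda>n. q ((S ^^ n) z)) n) = (\<lambda>x. (planar_map \<alpha> ^^ n) (x, 0)) \<circ> (q \<circ> S ^^ n)"
    by (simp add: fun_eq_iff past_point_def)
  show "(\<lambda>z. past_point (\<lambda>n. q ((S ^^ n) z)) n) \<in> borel_measurable K"
    unfolding eq using qS f by (rule measurable_comp)
  have "distr K (nu_alpha \<alpha>) (q \<circ> S ^^ n) = distr (distr K K (S ^^ n)) (nu_alpha \<alpha>) q"
    using q(1) Sn by (rule distr_distr[symmetric])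
  then have "distr K (nu_alpha \<alpha>) (q \<circ> S ^^ n) = nu_alpha \<alpha>" by (simp only: distr_iterate[OF S] q(2))
  then show "distr K borel (\<lambda>z. past_point (\<lambda>n. q ((S ^^ n) z)) n) = distr (nu_alpha \<alpha>) borel (\<lambda>x. (planar_map \<alpha> ^^ n) (x, 0))"
    unfolding eq using distr_distr[OF f qS] by simp
qed

text \<open>In \<open>mu_alpha \<alpha>\<close> the past also contains the true height \<open>n\<close> steps ago, and starting from that height leads back
  to \<open>p\<close>. By contraction, starting from height \<open>0\<close> leads to a point close to \<open>p\<close>.\<close>

lemma mu_alpha_as_limit_of_pasts:
  obtains S where "S \<in> measurable (mu_alpha \<alpha>) (mu_alpha \<alpha>)" "distr (mu_alpha \<alpha>) (mu_alpha \<alpha>) S = mu_alpha \<alpha>"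
    "AE p in mu_alpha \<alpha>. past_point (\<lambda>n. fst ((S ^^ n) p)) \<longlonglongrightarrow> p"
proof -
  obtain S where S: "S \<in> measurable (mu_alpha \<alpha>) (mu_alpha \<alpha>)" "distr (mu_alpha \<alpha>) (mu_alpha \<alpha>) S = mu_alpha \<alpha>"
    and RS: "AE p in mu_alpha \<alpha>. planar_map \<alpha> (S p) = p"
    using invertible_system_inverse[OF invertible_mu_alpha] .
  have "AE p in mu_alpha \<alpha>. past_point (\<lambda>n. fst ((S ^^ n) p)) \<longlonglongrightarrow> p"
    using AE_iterate[OF S RS] AE_space
  proof eventually_elim
    case (elim p)
    have Sn: "(S ^^ n) p \<in> Ival \<alpha> \<times> {0..1}" for n
      using measurable_space[OF measurable_compose_n[OF S(1)] elim(2), of n] Omega_bounds by auto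
    have returns: "(planar_map \<alpha> ^^ n) ((S ^^ n) p) = p" for n
    proof (induction n)
      case (Suc n)
      have "(planar_map \<alpha> ^^ Suc n) ((S ^^ Suc n) p) = (planar_map \<alpha> ^^ n) (planar_map \<alpha> (S ((S ^^ n) p)))"
        by (simp add: funpow_swap1)
      then show ?case using elim(1) Suc by simp
    qed simp
    have close: "\<bar>snd (past_point (\<lambda>n. fst ((S ^^ n) p)) n) - snd p\<bar> \<le> 1 / (1 + real n)" for n
      using fibre_contraction[of "fst ((S ^^ n) p)" 0 "snd ((S ^^ n) p)" n] Sn[of n] returns[of n]
      by (auto simp: past_point_def mem_Times_iff)
    have "fst (past_point (\<lambda>n. fst ((S ^^ n) p)) n) = fst p" for n
      using fst_planar_map_iter[of n "(S ^^ n) p"] fst_planar_map_iter[of n "(fst ((S ^^ n) p), 0)"] returns[of n]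
      by (simp add: past_point_def)
    then have pp: "past_point (\<lambda>n. fst ((S ^^ n) p)) = (\<lambda>n. (fst p, snd (past_point (\<lambda>n. fst ((S ^^ n) p)) n)))"
      by (metis prod.collapse)
    have "(\<lambda>n. snd (past_point (\<lambda>n. fst ((S ^^ n) p)) n)) \<longlonglongrightarrow> snd p"
    proof (rule LIMSEQ_I)
      fix e :: real assume "0 < e"
      then obtain m where m: "1 / real (Suc m) < e"
        using reals_Archimedean[of e] by (auto simp: inverse_eq_divide)
      have "norm (snd (past_point (\<lambda>n. fst ((S ^^ n) p)) n) - snd p) < e" if "m \<le> n" for n
      proof -
        have "1 / (1 + real n) \<le> 1 / real (Suc m)" using that by (intro frac_le) auto
        then show ?thesis using close[of n] m by simp
      qed
      then show "\<exists>m. \<forall>n\<ge>m. norm (snd (past_point (\<lambda>n. fst ((S ^^ n) p)) n) - snd p) < e" by blast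
    qed
    then have "(\<lambda>n. (fst p, snd (past_point (\<lambda>n. fst ((S ^^ n) p)) n))) \<longlonglongrightarrow> (fst p, snd p)"
      by (intro tendsto_Pair tendsto_const)
    then show ?case unfolding pp[symmetric] prod.collapse .
  qed
  then show thesis using that S by blast
qed

lemma AE_nu_alpha_not_right_end: "AE x in nu_alpha \<alpha>. x \<noteq> \<alpha>"
proof -
  have "AE p in cf_measure. p \<in> Omega \<alpha> \<longrightarrow> fst p \<noteq> \<alpha>"
    using AE_not_in_vertical_lines[of "{\<alpha>}"] by (auto elim: eventually_mono)
  then have "AE p in mu_alpha \<alpha>. fst p \<noteq> \<alpha>" by (rule AE_mu_alphaI)
  moreover have "{x \<in> space (nu_alpha \<alpha>). x \<noteq> \<alpha>} \<in> sets (nu_alpha \<alpha>)"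
  proof -
    have "{x \<in> space (nu_alpha \<alpha>). x \<noteq> \<alpha>} = Ival \<alpha> - {\<alpha>}" by auto
    then show ?thesis by (auto simp: sets_nu_alpha_iff Ival_def)
  qed
  ultimately have "AE x in distr (mu_alpha \<alpha>) (nu_alpha \<alpha>) fst. x \<noteq> \<alpha>" by (subst AE_distr_iff[OF fst_measurable]) auto
  then show ?thesis unfolding distr_fst .
qed

text \<open>The factor map \<open>\<Phi>\<close> sends \<open>z\<close> to the limit point of its past. It is equivariant because the past of
  \<open>R z\<close> is that of \<open>z\<close> with one new entry. Its law agrees with \<open>mu_alpha \<alpha>\<close>, because both are limits of the same
  laws.\<close>

lemma mu_alpha_minimal:
  assumes inv: "invertible_system K R" and fac: "has_factor K R (nu_alpha \<alpha>) (cf_map \<alpha>)"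
  shows "has_factor K R (mu_alpha \<alpha>) (planar_map \<alpha>)"
proof -
  interpret K: prob_space K using inv by (simp add: invertible_system_def measure_preserving_system_def)
  obtain S where S: "S \<in> measurable K K" "distr K K S = K"
    and SR: "AE z in K. S (R z) = z" and RS: "AE z in K. R (S z) = z"
    using invertible_system_inverse[OF inv] .
  obtain q where qf: "factor_map K R (nu_alpha \<alpha>) (cf_map \<alpha>) q" using fac by (auto simp: has_factor_def)
  then have q: "q \<in> measurable K (nu_alpha \<alpha>)" "distr K (nu_alpha \<alpha>) q = nu_alpha \<alpha>" "AE z in K. q (R z) = cf_map \<alpha> (q z)"
    by (auto simp: factor_map_def)
  define x where "x z n = q ((S ^^ n) z)" for z n
  define \<Phi>0 where "\<Phi>0 z = (x z 0, past_limit (x z))" for z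
  note pm [measurable] = past_point_distribution(1)[OF S q(1,2), folded x_def]
  have hist: "AE z in K. history (x z)"
    using AE_history[OF S RS qf] by (simp add: x_def[abs_def])
  have "AE z in K. q z \<noteq> \<alpha>"
    using AE_nu_alpha_not_right_end by (intro AE_distrD[OF q(1), of "\<lambda>x. x \<noteq> \<alpha>"]) (simp only: q(2))
  from AE_iterate[OF S this] have ne: "AE z in K. \<forall>n. x z n \<noteq> \<alpha>" by (simp add: x_def)
  have in_Omega: "AE z in K. \<Phi>0 z \<in> Omega \<alpha>"
    using hist ne
  proof eventually_elim
    case (elim z)
    have "x z n < \<alpha>" for n
      using history_in[OF elim(1), of n] elim(2) by (simp add: Ival_def less_le)
    from past_limit_in_Omega[OF elim(1) this] show ?case by (simp add: \<Phi>0_def)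
  qed
  have q_borel: "q \<in> borel_measurable K"
  proof -
    have "(\<lambda>x. x) \<in> borel_measurable (nu_alpha \<alpha>)"
      unfolding measurable_cong_sets[OF sets_nu_alpha refl] by (rule measurable_restrict_space1) simp
    from measurable_compose[OF q(1) this] show ?thesis by simp
  qed
  have \<Phi>0 [measurable]: "\<Phi>0 \<in> borel_measurable K"
  proof -
    have [measurable]: "(\<lambda>z. snd (past_point (x z) n)) \<in> borel_measurable K" for n
      using pm[of n] unfolding borel_prod[symmetric] by measurable
    have "(\<lambda>z. past_limit (x z)) \<in> borel_measurable K"
      unfolding past_limit_def by measurable
    then show ?thesis using q_borel by (simp add: \<Phi>0_def[abs_def] x_def)
  qed
  obtain p0 where p0: "p0 \<in> Omega \<alpha>"
    using emeasure_Omega_pos by (cases "Omega \<alpha> = {}") auto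
  \<comment> \<open>A fixed value \<open>p0\<close> on the null set where the limit point is not in \<open>Omega \<alpha>\<close>.\<close>
  define \<Phi> where "\<Phi> z = (if \<Phi>0 z \<in> Omega \<alpha> then \<Phi>0 z else p0)" for z
  have AE_\<Phi>: "AE z in K. \<Phi> z = \<Phi>0 z" using in_Omega by eventually_elim (simp add: \<Phi>_def)
  have \<Phi>_borel [measurable]: "\<Phi> \<in> borel_measurable K" unfolding \<Phi>_def by measurable
  have \<Phi>M: "\<Phi> \<in> measurable K (mu_alpha \<alpha>)"
    unfolding measurable_cong_sets[OF refl sets_mu_alpha[OF alpha_pos alpha_le_1]]
    by (rule measurable_restrict_space2) (auto simp: \<Phi>_def p0)
  have limK: "AE z in K. (\<lambda>n. past_point (x z) n) \<longlonglongrightarrow> \<Phi> z"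
    using hist AE_\<Phi> by eventually_elim (simp add: \<Phi>0_def past_point_tendsto)
  obtain V where V: "V \<in> measurable (mu_alpha \<alpha>) (mu_alpha \<alpha>)" "distr (mu_alpha \<alpha>) (mu_alpha \<alpha>) V = mu_alpha \<alpha>"
    and limM: "AE p in mu_alpha \<alpha>. past_point (\<lambda>n. fst ((V ^^ n) p)) \<longlonglongrightarrow> p"
    using mu_alpha_as_limit_of_pasts .
  have id_meas: "(\<lambda>p. p) \<in> borel_measurable (mu_alpha \<alpha>)"
    unfolding measurable_cong_sets[OF sets_mu_alpha[OF alpha_pos alpha_le_1] refl]
    by (rule measurable_restrict_space1) simp
  have law: "distr K borel \<Phi> = distr (mu_alpha \<alpha>) borel (\<lambda>p. p)"
  proof (rule distr_eq_of_AE_limits[OF K.prob_space_axioms prob_space_mu_alpha _ _ _ _ _ limK limM])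
    show "distr K borel (\<lambda>z. past_point (x z) n) = distr (mu_alpha \<alpha>) borel (\<lambda>p. past_point (\<lambda>n. fst ((V ^^ n) p)) n)" for n
      unfolding past_point_distribution(2)[OF S q(1,2), folded x_def]
        past_point_distribution(2)[OF V fst_measurable distr_fst] ..
    show "(\<lambda>p. past_point (\<lambda>n. fst ((V ^^ n) p)) n) \<in> borel_measurable (mu_alpha \<alpha>)" for n
      by (rule past_point_distribution(1)[OF V fst_measurable distr_fst])
  qed (fact pm \<Phi>_borel id_meas)+
  have "distr K (mu_alpha \<alpha>) \<Phi> = mu_alpha \<alpha>"
  proof (rule measure_eqI)
    fix A assume "A \<in> sets (distr K (mu_alpha \<alpha>) \<Phi>)"
    then have A: "A \<in> sets (mu_alpha \<alpha>)" "A \<in> sets borel" "A \<subseteq> Omega \<alpha>" by (auto simp: sets_mu_alpha_iff)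
    have "emeasure (distr K (mu_alpha \<alpha>) \<Phi>) A = emeasure K (\<Phi> -` A \<inter> space K)"
      by (rule emeasure_distr[OF \<Phi>M A(1)])
    also have "\<dots> = emeasure (distr K borel \<Phi>) A"
      by (rule emeasure_distr[OF \<Phi>_borel A(2), symmetric])
    also have "\<dots> = emeasure (mu_alpha \<alpha>) ((\<lambda>p. p) -` A \<inter> space (mu_alpha \<alpha>))"
      unfolding law by (rule emeasure_distr[OF id_meas A(2)])
    also have "(\<lambda>p. p) -` A \<inter> space (mu_alpha \<alpha>) = A" using A(3) by auto
    finally show "emeasure (distr K (mu_alpha \<alpha>) \<Phi>) A = emeasure (mu_alpha \<alpha>) A" .
  qed simp
  moreover have "AE z in K. \<Phi> (R z) = planar_map \<alpha> (\<Phi> z)"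
    using hist ne SR q(3) AE_\<Phi>
  proof eventually_elim
    case (elim z)
    have x0: "x (R z) 0 = cf_map \<alpha> (x z 0)" using elim(4) by (simp add: x_def)
    have xS: "x (R z) (Suc n) = x z n" for n
      using elim(3) by (simp add: x_def funpow_Suc_right del: funpow.simps)
    have lt: "x z n < \<alpha>" for n
      using history_in[OF elim(1), of n] elim(2) by (simp add: Ival_def less_le)
    have h': "history (x (R z))"
      unfolding history_def
    proof
      fix n
      show "x (R z) n \<in> Ival \<alpha> \<and> x (R z) n = cf_map \<alpha> (x (R z) (Suc n))"
      proof (cases n)
        case 0
        then show ?thesis using cf_map_half_open[of "x z 0"] by (simp add: x0 xS Ival_def)
      next
        case (Suc m)
        then show ?thesis using history_in[OF elim(1), of m] history_step[OF elim(1), of m] by (simp only: xS)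
      qed
    qed
    have "x (R z) n < \<alpha>" for n
      using lt cf_map_half_open[of "x z 0"] by (cases n) (auto simp: x0 xS)
    from past_limit_in_Omega[OF h' this] have "\<Phi> (R z) = \<Phi>0 (R z)" by (simp add: \<Phi>_def \<Phi>0_def)
    also have "\<dots> = planar_map \<alpha> (\<Phi>0 z)"
      unfolding \<Phi>0_def by (rule past_limit_shift[OF elim(1) h' xS, symmetric])
    finally show ?case using elim(5) by simp
  qed
  ultimately show ?thesis using \<Phi>M by (auto simp: has_factor_def factor_map_def)
qed

end

theorem theorem1:
  fixes \<alpha> :: real
  assumes "0 < \<alpha>" and "\<alpha> \<le> 1"
  shows "natural_extension TYPE('c)
           (mu_alpha \<alpha>) (planar_map \<alpha>) (nu_alpha \<alpha>) (cf_map \<alpha>) fst"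
proof -
  interpret alpha_cf \<alpha> using assms by unfold_locales
  show ?thesis
    unfolding natural_extension_def
    using planar_map_measure_preserving cf_map_measure_preserving fst_measurable fst_image_Omega
      distr_fst fst_planar_map invertible_mu_alpha by (auto intro: mu_alpha_minimal)
qed

end
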